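(* Let $\ell$ be the signal attenuation function and assume $\int_0^\infty x\,\ell(x)\,dx<\infty$. Then for any eavesdropper intensity $\lambda_E>0$ there exist $\lambda'<\infty$ and a function $\gamma'(\lambda,\lambda_E)>0$ such that, in the SINR secrecy graph $SSG$, $P(|C_{x_1}|=\infty)>0$ for every legitimate-node intensity $\lambda>\lambda'$ and every $\gamma\in(0,1]$ with $\gamma<\gamma'(\lambda,\lambda_E)$.
   Context: Legitimate nodes form a Poisson point process $\Phi$ on $\mathbb{R}^2$ of intensity $\lambda>0$; eavesdropper nodes form an independent Poisson point process $\Phi_E$ on $\mathbb{R}^2$ of intensity $\lambda_E>0$. The attenuation function depends only on distance: $\ell(x,y)=\ell(|x-y|)$, where $\ell:[0,\infty)\to[0,1]$ is strictly decreasing. The interference suppression parameter is $\gamma\in(0,1]$. For distinct $x_i,x_j\in\Phi$ and $e\in\Phi_E$ put $$\mathsf{SINR}_{ij}=\frac{\ell(x_i,x_j)}{1+\gamma\sum_{x_k\in\Phi,\,k\neq i,j}\ell(x_k,x_j)},\qquad \mathsf{SINR}_{ie}=\frac{\ell(x_i,e)}{1+\sum_{x_k\in\Phi,\,k\ne i}\ell(x_k,e)} .$$ (There is no factor $\gamma$ in $\mathsf{SINR}_{ie}$.) The SINR secrecy graph $SSG$ is the directed graph with vertex set $\Phi$ and a directed edge $(x_i,x_j)$ if and only if $\mathsf{SINR}_{ij}>\mathsf{SINR}_{ie}$ for all $e\in\Phi_E$. The connected component of $x_j\in\Phi$ is its out-component: $C_{x_j}$ is the set of $x_k\in\Phi$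 such that there is a directed path in $SSG$ from $x_j$ to $x_k$; $|C_{x_j}|$ is its cardinality. By stationarity one considers a typical node $x_1$ of $\Phi$ placed at the origin (i.e. $P$ is taken with $\Phi$ conditioned to have a point $x_1$ at the origin; equivalently, a point at the origin is added to $\Phi$). *)

theory Defs
  imports "HOL-Probability.Probability"
begin

section \<open>Point configurations and Poisson point processes\<close>

definition locally_finite_set :: "'a::metric_space set \<Rightarrow> bool" where
  "locally_finite_set S \<longleftrightarrow> (\<forall>B. bounded B \<longrightarrow> finite (S \<inter> B))"

text \<open>
  A simple point process is a random locally finite set; \<open>config_space\<close> carries the usual
  sigma-algebra generated by the counting maps \<open>S \<mapsto> card (S \<inter> B)\<close> for bounded Borel sets \<open>B\<close>.
\<close>

definition config_space :: "'a::euclidean_space set measure" where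
  "config_space = sigma {S. locally_finite_set S}
     {{S. locally_finite_set S \<and> card (S \<inter> B) = n} | B n. B \<in> sets borel \<and> bounded B}"

lemma space_config_space: "space config_space = {S. locally_finite_set S}"
  unfolding config_space_def by (rule space_measure_of) auto

lemma sets_config_space:
  "sets config_space = sigma_sets {S. locally_finite_set S}
     {{S. locally_finite_set S \<and> card (S \<inter> B) = n} | B n. B \<in> sets borel \<and> bounded B}"
  unfolding config_space_def by (rule sets_measure_of) auto

text \<open>
  The Poisson probabilities are written out rather than taken from \<^const>\<open>poisson_pmf\<close>, which
  requires a positive rate, whereas \<open>B\<close> may be a null set here.
\<close>

definition poisson_point_process ::
    "'w measure \<Rightarrow> real \<Rightarrow> ('w \<Rightarrow> 'a::euclidean_space set) \<Rightarrow> bool" where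
  "poisson_point_process M lam \<Phi> \<longleftrightarrow>
     prob_space M \<and>
     \<Phi> \<in> measurable M config_space \<and>
     (\<forall>B n. B \<in> sets borel \<longrightarrow> bounded B \<longrightarrow>
        measure M {\<omega> \<in> space M. card (\<Phi> \<omega> \<inter> B) = n} =
          (lam * measure lborel B) ^ n / fact n * exp (- (lam * measure lborel B))) \<and>
     (\<forall>\<B>. finite \<B> \<longrightarrow> (\<forall>B\<in>\<B>. B \<in> sets borel \<and> bounded B) \<longrightarrow> disjoint \<B> \<longrightarrow>
        prob_space.indep_vars M (\<lambda>_. count_space UNIV) (\<lambda>B \<omega>. card (\<Phi> \<omega> \<inter> B)) \<B>)"

section \<open>The SINR secrecy graph\<close>

text \<open>
  Ratios are formed in \<^typ>\<open>ennreal\<close>, so that a divergent interference sum is \<open>\<infinity>\<close> and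
  makes the ratio 0; a real-valued infinite sum would be 0 in that case.
\<close>

definition sinr_node ::
    "(real \<Rightarrow> real) \<Rightarrow> real \<Rightarrow> 'a::metric_space set \<Rightarrow> 'a \<Rightarrow> 'a \<Rightarrow> ennreal" where
  "sinr_node l \<gamma> X x y =
     ennreal (l (dist x y)) / (1 + ennreal \<gamma> * (\<Sum>\<^sub>\<infinity>z\<in>X - {x, y}. ennreal (l (dist z y))))"

definition sinr_eavesdropper ::
    "(real \<Rightarrow> real) \<Rightarrow> 'a::metric_space set \<Rightarrow> 'a \<Rightarrow> 'a \<Rightarrow> ennreal" where
  "sinr_eavesdropper l X x e =
     ennreal (l (dist x e)) / (1 + (\<Sum>\<^sub>\<infinity>z\<in>X - {x}. ennreal (l (dist z e))))"

definition ssg_edges ::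
    "(real \<Rightarrow> real) \<Rightarrow> real \<Rightarrow> 'a::metric_space set \<Rightarrow> 'a set \<Rightarrow> ('a \<times> 'a) set" where
  "ssg_edges l \<gamma> X E =
     {(x, y). x \<in> X \<and> y \<in> X \<and> x \<noteq> y \<and>
        (\<forall>e\<in>E. sinr_node l \<gamma> X x y > sinr_eavesdropper l X x e)}"

definition out_component ::
    "(real \<Rightarrow> real) \<Rightarrow> real \<Rightarrow> 'a::metric_space set \<Rightarrow> 'a set \<Rightarrow> 'a \<Rightarrow> 'a set" where
  "out_component l \<gamma> X E x = {y \<in> X. (x, y) \<in> (ssg_edges l \<gamma> X E)\<^sup>*}"

end

theory Submission
  imports Defs
begin

text \<open>
  Cut the plane into squares of side \<open>s\<close>, so small that \<open>lamE * s\<^sup>2\<close> is tiny. Call a square bad if it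
  contains no legitimate node, if the block of 9 by 9 squares around it contains an eavesdropper, or
  if the interference in it exceeds a threshold \<open>T\<close>. Nodes \<open>x\<close> and \<open>y\<close> of adjacent good squares satisfy
  \<open>dist x y \<le> 3 * s\<close>, while every eavesdropper has distance at least \<open>4 * s\<close> from \<open>x\<close>; as
  \<open>l (4 * s) < l (3 * s)\<close>, both directed edges are present once \<open>\<gamma> * (T + 1)\<close> is small. Hence it is
  enough that the good squares percolate from the origin, which a Peierls argument gives as soon as
  the probability that \<open>m\<close> given squares are all bad is at most \<open>6 ^ (- 4 * m)\<close>.

  The three sources of badness, of which the last has infinite range, are handled by one exponential
  Markov inequality. The sum over the given squares of the number of defects, with the interference
  counted as a multiple of \<open>T\<close>, is a linear combination of the independent Poisson counts of all
  squares. The coefficients of the interference part are bounded by \<open>A / T\<close> and their sum by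
  \<open>m * A / T\<close>, where \<open>A\<close> is a bound for the sums of \<open>l\<close> over the lattice, finite because
  \<open>\<integral> r * l r dr\<close> is.
\<close>

section \<open>Contours and the Peierls argument\<close>

definition rot :: "int \<times> int \<Rightarrow> int \<times> int" where
  "rot d = (- snd d, fst d)"

definition dirs :: "(int \<times> int) set" where
  "dirs = {(1, 0), (0, 1), (-1, 0), (0, -1)}"

text \<open>
  The wall \<open>(u, d)\<close> is the unit edge of the dual lattice between the sites \<open>u\<close> and \<open>u + d\<close>. The boundary
  of a set is followed with the set on the left, hence in direction \<open>rot d\<close>.
\<close>

type_synonym wall = "(int \<times> int) \<times> (int \<times> int)"

definition outer_boundary :: "(int \<times> int) set \<Rightarrow> wall set" where
  "outer_boundary C = {(u, d). u \<in> C \<and> d \<in> dirs \<and> u + d \<notin> C}"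

text \<open>The wall \<open>(u, d)\<close> ends at the corner shared by the sites \<open>u\<close>,
  \<open>u + d\<close>, \<open>u + rot d\<close> and \<open>u + d + rot d\<close>. The three moves
  are the other walls leaving this corner, each with its inner site on the left.\<close>

definition turn_left :: "wall \<Rightarrow> wall" where
  "turn_left = (\<lambda>(u, d). (u, rot d))"

definition go_ahead :: "wall \<Rightarrow> wall" where
  "go_ahead = (\<lambda>(u, d). (u + rot d, d))"

definition turn_right :: "wall \<Rightarrow> wall" where
  "turn_right = (\<lambda>(u, d). (u + d + rot d, - rot d))"

definition next_wall :: "(int \<times> int) set \<Rightarrow> wall \<Rightarrow> wall" where
  "next_wall C b =
    (if fst b + rot (snd b) \<notin> C then turn_left b
     else if fst b + snd b + rot (snd b) \<notin> C then go_ahead b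
     else turn_right b)"

lemmas wall_defs = outer_boundary_def next_wall_def turn_left_def go_ahead_def turn_right_def
  dirs_def rot_def

lemma finite_outer_boundary: "finite C \<Longrightarrow> finite (outer_boundary C)"
  by (rule finite_subset[of _ "C \<times> dirs"]) (auto simp: outer_boundary_def dirs_def)

text \<open>
  At a corner where two boundary walls could be followed, the left turn is taken. This is what makes
  \<open>next_wall C\<close> injective, so that it permutes the boundary of a finite set and its orbits are closed
  contours.
\<close>

lemma outer_boundary_cases:
  assumes "b \<in> outer_boundary C"
  obtains x y where "b = ((x, y), (1, 0))" | x y where "b = ((x, y), (0, 1))"
    | x y where "b = ((x, y), (-1, 0))" | x y where "b = ((x, y), (0, -1))"
  using assms by (auto simp: outer_boundary_def dirs_def)

lemma next_wall_in_outer_boundary: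
  assumes "b \<in> outer_boundary C"
  shows "next_wall C b \<in> outer_boundary C"
  using assms by (cases rule: outer_boundary_cases[OF assms]) (simp_all add: wall_defs)

lemma inj_on_next_wall: "inj_on (next_wall C) (outer_boundary C)"
proof (rule inj_on_inverseI)
  fix b assume b: "b \<in> outer_boundary C"
  \<comment> \<open>The inverse runs the same rule backwards: \<open>s\<close> points against the
    direction of travel, and the two sites behind the starting corner decide which move led to
    \<open>(v, e)\<close>.\<close>
  show "(\<lambda>(v, e). let s = - rot e in
      if v + s \<notin> C then (v, s) else if v + s + e \<notin> C then (v + s, e)
      else (v + s + e, - s)) (next_wall C b) = b"
    using b by (cases rule: outer_boundary_cases[OF b]) (simp_all add: wall_defs)
qed

text \<open>
  \<open>wall_start b\<close> is half a unit below the height of the corner at which the wall \<open>b\<close> starts,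
  \<open>wall_pos b\<close> is twice the abscissa of its midpoint, and \<open>crossing b\<close> tells whether \<open>b\<close> crosses the
  row \<open>y = 0\<close> upwards or downwards.
\<close>

definition wall_start :: "wall \<Rightarrow> int" where
  "wall_start b = snd (fst b) - (if snd b = (1, 0) \<or> snd b = (0, -1) then 1 else 0)"

definition crossing :: "wall \<Rightarrow> int" where
  "crossing b = (if snd (fst b) \<noteq> 0 then 0
     else if snd b = (1, 0) then 1 else if snd b = (-1, 0) then -1 else 0)"

definition wall_pos :: "wall \<Rightarrow> int" where
  "wall_pos b = 2 * fst (fst b) + fst (snd b)"

text \<open>The successor starts at the corner where \<open>b\<close> ends. Hence the indicator of a
  corner lying above the row changes along \<open>b\<close> exactly when \<open>b\<close> crosses
  the row, and crossings telescope along orbits.\<close>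

lemma crossing_eq:
  assumes "b \<in> outer_boundary C"
  shows "crossing b = of_bool (wall_start (next_wall C b) \<ge> 0) - of_bool (wall_start b \<ge> 0)"
  using assms
  by (cases rule: outer_boundary_cases)
     (auto simp: next_wall_def turn_left_def go_ahead_def turn_right_def rot_def crossing_def wall_start_def)

text \<open>An injective self-map of a finite set is a permutation, so after reindexing the two
  indicator sums from \<open>crossing_eq\<close> cancel.\<close>

lemma sum_crossing_invariant:
  assumes "finite S" "S \<subseteq> outer_boundary C" "next_wall C ` S \<subseteq> S"
  shows "sum crossing S = 0"
proof -
  have inj: "inj_on (next_wall C) S"
    using inj_on_next_wall assms(2) by (rule inj_on_subset)
  then have im: "next_wall C ` S = S"
    using assms by (simp add: endo_inj_surj)
  have "sum crossing S = (\<Sum>b\<in>S. of_bool (wall_start (next_wall C b) \<ge> 0)) 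
      - (\<Sum>b\<in>S. of_bool (wall_start b \<ge> 0))"
    unfolding sum_subtractf[symmetric] using assms(2) by (intro sum.cong crossing_eq) auto
  also have "(\<Sum>b\<in>S. of_bool (wall_start (next_wall C b) \<ge> 0) :: int)
      = (\<Sum>b\<in>next_wall C ` S. of_bool (wall_start b \<ge> 0))"
    using inj by (simp add: sum.reindex)
  finally show ?thesis by (simp add: im)
qed

text \<open>\<open>C\<close> meets the nonnegative half axis in runs of sites. Every run has a right
  end, crossed upwards, and a left end, crossed downwards, except that the run through the origin
  has no left end on the positive half axis.\<close>

lemma sum_crossing_positive_axis:
  assumes "finite C" "(0, 0) \<in> C"
  shows "sum crossing {b \<in> outer_boundary C. wall_pos b > 0} = 1"
proof -
  define R where "R = {x::int. x \<ge> 0 \<and> (x, 0::int) \<in> C}"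
  have finR: "finite R"
  proof (rule finite_subset)
    show "R \<subseteq> fst ` C"
    proof
      fix x assume "x \<in> R"
      then show "x \<in> fst ` C" by (intro image_eqI[of _ _ "(x, 0)"]) (auto simp: R_def)
    qed
  qed (use assms in simp)
  define E where "E = {x \<in> R. x + 1 \<notin> R}"
  define W where "W = {x \<in> R. x \<noteq> 0 \<and> x - 1 \<notin> R}"
  let ?e = "\<lambda>x::int. ((x, 0::int), (1::int, 0::int))" and ?w = "\<lambda>x::int. ((x, 0::int), (-1::int, 0::int))"
  let ?P = "{b \<in> outer_boundary C. wall_pos b > 0}"
  have fin: "finite ?P" using finite_outer_boundary[OF assms(1)] by simp
  have sub: "?e ` E \<union> ?w ` W \<subseteq> ?P"
    by (auto simp: E_def W_def R_def outer_boundary_def dirs_def wall_pos_def)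
  have zero: "crossing b = 0" if "b \<in> ?P - (?e ` E \<union> ?w ` W)" for b
  proof (rule ccontr)
    assume "crossing b \<noteq> 0"
    moreover obtain x y d where b: "b = ((x, y), d)" by (metis surj_pair)
    ultimately have y: "y = 0" and d: "d = (1, 0) \<or> d = (-1, 0)"
      by (auto simp: crossing_def split: if_splits)
    have P: "b \<in> outer_boundary C" "wall_pos b > 0" using that by auto
    from d show False
    proof
      assume d: "d = (1, 0)"
      with P have "x \<in> E" by (simp add: E_def R_def b y outer_boundary_def wall_pos_def)
      then show False using that by (simp add: b y d)
    next
      assume d: "d = (-1, 0)"
      with P have "x \<in> W" by (simp add: W_def R_def b y outer_boundary_def wall_pos_def)
      then show False using that by (simp add: b y d)
    qed
  qed
  have finEW: "finite E" "finite W" using finR by (auto simp: E_def W_def)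
  have "sum crossing ?P = sum crossing (?e ` E \<union> ?w ` W)"
    using fin sub zero by (intro sum.mono_neutral_right) auto
  also have "\<dots> = sum crossing (?e ` E) + sum crossing (?w ` W)"
    using finEW by (intro sum.union_disjoint) auto
  also have "sum crossing (?e ` E) = int (card E)"
    by (subst sum.reindex) (auto simp: inj_on_def crossing_def)
  also have "sum crossing (?w ` W) = - int (card W)"
    by (subst sum.reindex) (auto simp: inj_on_def crossing_def)
  \<comment> \<open>The shift by 1 matches the sites of \<open>R\<close> having a right neighbour in
    \<open>R\<close> with those having a left neighbour in \<open>R\<close>. What remains on the two
    sides is \<open>E\<close>, and \<open>W\<close> together with the site 0.\<close>
  also have "int (card E) + - int (card W) = 1"
  proof -
    have "0 \<in> R" using assms by (simp add: R_def)
    have 1: "card R = card E + card {x \<in> R. x + 1 \<in> R}"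
    proof -
      have "E \<union> {x \<in> R. x + 1 \<in> R} = R"
        by (auto simp: E_def)
      moreover have "card (E \<union> {x \<in> R. x + 1 \<in> R}) = card E + card {x \<in> R. x + 1 \<in> R}"
        by (rule card_Un_disjoint) (use finR in \<open>auto simp: E_def\<close>)
      ultimately show ?thesis by simp
    qed
    have 2: "card (R - {0}) = card W + card {x \<in> R. x \<noteq> 0 \<and> x - 1 \<in> R}"
    proof -
      have "W \<union> {x \<in> R. x \<noteq> 0 \<and> x - 1 \<in> R} = R - {0}"
        by (auto simp: W_def)
      moreover have "card (W \<union> {x \<in> R. x \<noteq> 0 \<and> x - 1 \<in> R}) = card W + card {x \<in> R. x \<noteq> 0 \<and> x - 1 \<in> R}"
        by (rule card_Un_disjoint) (use finR in \<open>auto simp: W_def\<close>)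
      ultimately show ?thesis by simp
    qed
    have "bij_betw (\<lambda>x. x + 1) {x \<in> R. x + 1 \<in> R} {x \<in> R. x \<noteq> 0 \<and> x - 1 \<in> R}"
      by (rule bij_betw_byWitness[where f' = "\<lambda>x. x - 1"]) (auto simp: R_def)
    then have 3: "card {x \<in> R. x + 1 \<in> R} = card {x \<in> R. x \<noteq> 0 \<and> x - 1 \<in> R}"
      by (rule bij_betw_same_card)
    have "card R = Suc (card (R - {0}))"
      using \<open>0 \<in> R\<close> finR by (rule card.remove[rotated])
    with 1 2 3 show ?thesis by simp
  qed
  finally show ?thesis by simp
qed

text \<open>Consecutive walls share a corner, so the abscissas of their midpoints differ by at most
  1. This forces contours reaching far out to be long.\<close>

lemma next_wall_pos:
  assumes "b \<in> outer_boundary C"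
  shows "wall_pos (next_wall C b) \<ge> wall_pos b - 2"
  using assms by (cases rule: outer_boundary_cases[OF assms]) (simp_all add: wall_defs wall_pos_def)

lemma funpow_next_wall_in: "b \<in> outer_boundary C \<Longrightarrow> (next_wall C ^^ n) b \<in> outer_boundary C"
  by (induction n) (auto intro: next_wall_in_outer_boundary)

lemma funpow_next_wall_pos:
  assumes "b \<in> outer_boundary C"
  shows "wall_pos ((next_wall C ^^ n) b) \<ge> wall_pos b - 2 * int n"
proof (induction n)
  case (Suc n)
  then show ?case using next_wall_pos[OF funpow_next_wall_in[OF assms, of n]] by simp
qed simp

text \<open>Both orientations of one dual edge, because either of the two sites it separates may be
  the one in the set.\<close>

definition axis_walls :: "nat \<Rightarrow> wall set" where
  "axis_walls a = {((int a, 0), (1, 0)), ((int a + 1, 0), (-1, 0))}"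

text \<open>
  Signed crossings of the row cancel along every orbit, but over the positive half axis they sum to 1.
  So some orbit crosses both the positive half axis, between \<open>a\<close> and \<open>a + 1\<close>, and the negative one,
  and therefore has more than \<open>a + 1\<close> walls.
\<close>

lemma exists_contour:
  assumes "finite C" "(0, 0) \<in> C"
  obtains a b where "b \<in> axis_walls a" "\<And>i. (next_wall C ^^ i) b \<in> outer_boundary C"
    "inj_on (\<lambda>i. (next_wall C ^^ i) b) {..Suc a}"
proof -
  let ?B = "outer_boundary C" and ?f = "next_wall C"
  \<comment> \<open>\<open>S\<close> is the union of the orbits that cross the row only on the
    positive half axis. If all crossings of that half axis lay in \<open>S\<close>, their sum would
    be both 0 and 1.\<close>
  define S where "S = {b \<in> ?B. \<forall>n. crossing ((?f ^^ n) b) \<noteq> 0 \<longrightarrow> wall_pos ((?f ^^ n) b) > 0}"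
  have finB: "finite ?B" using assms by (simp add: finite_outer_boundary)
  have "sum crossing S = 0"
  proof (rule sum_crossing_invariant)
    show "?f ` S \<subseteq> S"
    proof (rule image_subsetI)
      fix b assume b: "b \<in> S"
      have "crossing ((?f ^^ Suc n) b) \<noteq> 0 \<longrightarrow> wall_pos ((?f ^^ Suc n) b) > 0" for n
        using b unfolding S_def by blast
      then have "crossing ((?f ^^ n) (?f b)) \<noteq> 0 \<longrightarrow> wall_pos ((?f ^^ n) (?f b)) > 0" for n
        by (simp only: funpow.simps comp_apply funpow_swap1)
      then show "?f b \<in> S"
        using b by (simp add: S_def next_wall_in_outer_boundary)
    qed
  qed (use finB in \<open>auto simp: S_def\<close>)
  moreover have "sum crossing S = sum crossing {b \<in> S. wall_pos b > 0}"
  proof (rule sum.mono_neutral_right)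
    show "\<forall>b\<in>S - {b \<in> S. wall_pos b > 0}. crossing b = 0"
      by (force simp: S_def dest: spec[of _ "0::nat"])
  qed (use finB in \<open>auto simp: S_def\<close>)
  ultimately have "sum crossing {b \<in> S. wall_pos b > 0} \<noteq> sum crossing {b \<in> ?B. wall_pos b > 0}"
    using sum_crossing_positive_axis[OF assms] by simp
  then have "\<exists>b \<in> ?B - S. wall_pos b > 0 \<and> crossing b \<noteq> 0"
  proof (rule contrapos_np)
    assume *: "\<not> (\<exists>b \<in> ?B - S. wall_pos b > 0 \<and> crossing b \<noteq> 0)"
    show "sum crossing {b \<in> S. wall_pos b > 0} = sum crossing {b \<in> ?B. wall_pos b > 0}"
    proof (rule sum.mono_neutral_left)
      show "{b \<in> S. wall_pos b > 0} \<subseteq> {b \<in> ?B. wall_pos b > 0}"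
        by (auto simp: S_def)
    qed (use finB * in auto)
  qed
  then obtain b where b: "b \<in> ?B" "b \<notin> S" "wall_pos b > 0" "crossing b \<noteq> 0" by auto
  define Q where "Q n \<longleftrightarrow> wall_pos ((?f ^^ n) b) \<le> 0 \<and> crossing ((?f ^^ n) b) \<noteq> 0" for n
  have "\<exists>n. Q n" using b(1,2) by (auto simp: S_def Q_def not_less)
  define n where "n = (LEAST n. Q n)"
  have n: "Q n" "\<And>k. k < n \<Longrightarrow> \<not> Q k"
    unfolding n_def using \<open>\<exists>n. Q n\<close> by (auto intro: LeastI_ex dest: not_less_Least)
  \<comment> \<open>A repetition among the first walls could be cut out, which would bring the orbit
    to the negative half axis before the minimal time \<open>n\<close>.\<close>
  have inj: "inj_on (\<lambda>i. (?f ^^ i) b) {..n}"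
  proof (rule linorder_inj_onI)
    fix i j assume ij: "i < j" "j \<in> {..n}"
    show "(?f ^^ i) b \<noteq> (?f ^^ j) b"
    proof
      assume "(?f ^^ i) b = (?f ^^ j) b"
      then have "(?f ^^ (n - j)) ((?f ^^ i) b) = (?f ^^ (n - j)) ((?f ^^ j) b)" by simp
      then have "(?f ^^ (n - j + i)) b = (?f ^^ n) b"
        using ij by (simp only: funpow_add[THEN fun_cong, unfolded comp_apply, symmetric]) simp
      then have "Q (n - j + i)" using n(1) by (simp add: Q_def)
      moreover have "n - j + i < n" using ij by auto
      ultimately show False using n(2)[of "n - j + i"] by blast
    qed
  qed auto
  obtain x y d where bb: "b = ((x, y), d)" by (metis surj_pair)
  with b have y: "y = 0" and d: "d = (1, 0) \<or> d = (-1, 0)"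
    by (auto simp: crossing_def split: if_splits)
  define a where "a = nat ((wall_pos b - 1) div 2)"
  have a: "b \<in> axis_walls a" and pos: "wall_pos b = 2 * int a + 1"
    using b(3) d by (auto simp: axis_walls_def bb y wall_pos_def a_def)
  \<comment> \<open>Crossing walls have odd position, so a position at most 0 is at most -1. Falling
    there from \<open>2 * a + 1\<close> by at most 2 per step takes at least \<open>a + 1\<close>
    steps.\<close>
  have "wall_pos ((?f ^^ n) b) \<noteq> 0"
  proof
    assume "wall_pos ((?f ^^ n) b) = 0"
    moreover have "odd (fst (snd ((?f ^^ n) b)))"
      using n(1) by (auto simp: Q_def crossing_def split: if_splits)
    ultimately show False unfolding wall_pos_def by (metis even_add even_zero dvd_triv_left)
  qed
  then have "wall_pos ((?f ^^ n) b) \<le> -1" using n(1) by (simp add: Q_def)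
  then have "2 * int n \<ge> 2 * int a + 2"
    using funpow_next_wall_pos[OF b(1), of n] pos by simp
  then have "{..Suc a} \<subseteq> {..n}" by auto
  with inj have "inj_on (\<lambda>i. (?f ^^ i) b) {..Suc a}" by (rule inj_on_subset)
  with a b(1) show thesis by (intro that) (auto intro: funpow_next_wall_in)
qed

section \<open>Counting walks along walls\<close>

fun walks :: "nat \<Rightarrow> wall \<Rightarrow> wall list set" where
  "walks 0 b = {[b]}"
| "walks (Suc n) b = (\<Union>f\<in>{turn_left, go_ahead, turn_right}. (#) b ` walks n (f b))"

lemma finite_walks: "finite (walks n b)"
  by (induction n arbitrary: b) auto

lemma card_walks: "card (walks n b) \<le> 3 ^ n"
proof (induction n arbitrary: b)
  case (Suc n)
  have "card (walks (Suc n) b) \<le> (\<Sum>f\<in>{turn_left, go_ahead, turn_right}. card ((#) b ` walks n (f b)))"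
    unfolding walks.simps by (rule card_UN_le) simp
  also have "\<dots> \<le> (\<Sum>f\<in>{turn_left, go_ahead, turn_right}. 3 ^ n)"
    by (intro sum_mono order.trans[OF card_image_le[OF finite_walks] Suc])
  also have "\<dots> = card {turn_left, go_ahead, turn_right} * 3 ^ n" by simp
  also have "\<dots> \<le> 3 * 3 ^ n"
    by (intro mult_right_mono) (auto simp: card_insert_if)
  finally show ?case by simp
qed simp

lemma length_walks: "es \<in> walks n b \<Longrightarrow> length es = Suc n"
proof (induction n arbitrary: b es)
  case (Suc n)
  then show ?case unfolding walks.simps by (auto simp only: Suc.IH list.size)
qed simp

text \<open>Walks forget the set \<open>C\<close>: whatever the set, an initial piece of a contour
  is one of at most \<open>3 ^ n\<close> lists, which makes a union bound possible.\<close>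

lemma next_wall_walk: "map (\<lambda>i. (next_wall C ^^ i) b) [0..<Suc n] \<in> walks n b"
proof (induction n arbitrary: b)
  case (Suc n)
  have "map (\<lambda>i. (next_wall C ^^ i) b) [0..<Suc (Suc n)] 
      = b # map (\<lambda>i. (next_wall C ^^ i) (next_wall C b)) [0..<Suc n]"
    by (subst upt_conv_Cons) (simp_all add: map_Suc_upt[symmetric] funpow_swap1 del: upt_Suc)
  moreover have "next_wall C b \<in> (\<lambda>f. f b) ` {turn_left, go_ahead, turn_right}"
    by (simp add: next_wall_def)
  ultimately show ?case
    using Suc[of "next_wall C b"] unfolding walks.simps by (auto simp del: upt_Suc)
qed simp

lemma in_dirs_turn:
  assumes "snd b \<in> dirs" "f \<in> {turn_left, go_ahead, turn_right}"
  shows "snd (f b) \<in> dirs"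
  using assms by (cases b) (auto simp: wall_defs)

lemma snd_walks: "es \<in> walks n b \<Longrightarrow> snd b \<in> dirs \<Longrightarrow> snd ` set es \<subseteq> dirs"
proof (induction n arbitrary: b es)
  case (Suc n)
  from Suc.prems(1) obtain f es' where f: "f \<in> {turn_left, go_ahead, turn_right}"
    and es: "es = b # es'" "es' \<in> walks n (f b)"
    by (auto simp del: insert_iff)
  show ?case using Suc.IH[OF es(2) in_dirs_turn[OF Suc.prems(2) f]] es Suc.prems by auto
qed auto

definition outer_sites :: "wall list \<Rightarrow> (int \<times> int) set" where
  "outer_sites es = (\<lambda>(u, d). u + d) ` set es"

lemma finite_outer_sites: "finite (outer_sites es)"
  by (simp add: outer_sites_def)

text \<open>A site is the outer site of at most four walls, one for each direction. This loss is the
  factor 4 in the decay assumed in \<open>peierls\<close>.\<close>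

lemma card_outer_sites:
  assumes "distinct es" "snd ` set es \<subseteq> dirs"
  shows "length es \<le> 4 * card (outer_sites es)"
proof -
  have "set es \<subseteq> (\<lambda>(v, d). (v - d, d)) ` (outer_sites es \<times> dirs)"
  proof safe
    fix u d assume "(u, d) \<in> set es"
    then show "(u, d) \<in> (\<lambda>(v, d). (v - d, d)) ` (outer_sites es \<times> dirs)"
      using assms(2) by (intro image_eqI[of _ _ "(u + d, d)"]) (force simp: outer_sites_def)+
  qed
  then have "card (set es) \<le> card (outer_sites es \<times> dirs)"
    by (rule surj_card_le[rotated]) (auto simp: finite_outer_sites dirs_def)
  then show ?thesis
    using distinct_card[OF assms(1)] by (simp add: card_cartesian_product dirs_def)
qed

section \<open>The Peierls estimate\<close>

context prob_space
begin

text \<open>If all outer neighbours of a finite set around the origin were bad, so would be the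
  outer sites of its contour. At most \<open>2 * 3 ^ (a + 1)\<close> walks with \<open>a + 2\<close>
  walls start in \<open>axis_walls a\<close>, and each has only bad outer sites with probability at
  most \<open>(1/6) ^ (a + 2)\<close>. Summed over \<open>a\<close> this gives 1/3, which leaves
  room for the event that the origin is bad.\<close>

lemma peierls:
  fixes bad :: "int \<times> int \<Rightarrow> 'a set"
  assumes bad: "\<And>z. bad z \<in> events"
    and decay: "\<And>S. finite S \<Longrightarrow> S \<noteq> {} \<Longrightarrow> prob (\<Inter>z\<in>S. bad z) \<le> (1 / 6) ^ (4 * card S)"
  obtains G where "G \<in> events" "prob G > 0" "\<And>\<omega>. \<omega> \<in> G \<Longrightarrow> \<omega> \<notin> bad (0, 0)"
    "\<And>\<omega> C. \<omega> \<in> G \<Longrightarrow> finite C \<Longrightarrow> (0, 0) \<in> C \<Longrightarrow> \<exists>u\<in>C. \<exists>d\<in>dirs. u + d \<notin> C \<and> \<omega> \<notin> bad (u + d)"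
proof -
  \<comment> \<open>Of a contour only the first \<open>a + 2\<close> walls are used:
    \<open>exists_contour\<close> guarantees that they are distinct, and so that they have enough
    outer sites.\<close>
  define K where "K a = {es \<in> (\<Union>b\<in>axis_walls a. walks (Suc a) b). distinct es}" for a
  define H where "H a = (\<Union>es\<in>K a. \<Inter>z\<in>outer_sites es. bad z)" for a
  have finK: "finite (K a)" for a
    by (auto simp: K_def axis_walls_def finite_walks)
  have Kne: "outer_sites es \<noteq> {}" if "es \<in> K a" for es a
    using that length_walks unfolding K_def outer_sites_def by fastforce
  have ev1: "(\<Inter>z\<in>outer_sites es. bad z) \<in> events" if "es \<in> K a" for es a
    using Kne[OF that] by (intro sets.finite_INT finite_outer_sites bad)
  have H: "H a \<in> events" for a
    unfolding H_def by (intro sets.finite_UN finK ev1)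
  have cardK: "card (K a) \<le> 2 * 3 ^ Suc a" for a
  proof -
    have "card (K a) \<le> card (\<Union>b\<in>axis_walls a. walks (Suc a) b)"
      unfolding K_def by (intro card_mono) (auto simp: axis_walls_def finite_walks simp del: walks.simps)
    also have "\<dots> \<le> (\<Sum>b\<in>axis_walls a. card (walks (Suc a) b))"
      by (intro card_UN_le) (simp add: axis_walls_def)
    also have "\<dots> \<le> (\<Sum>b\<in>axis_walls a. 3 ^ Suc a)"
      by (intro sum_mono card_walks)
    also have "\<dots> = 2 * 3 ^ Suc a" by (simp add: axis_walls_def)
    finally show ?thesis .
  qed
  have es_le: "prob (\<Inter>z\<in>outer_sites es. bad z) \<le> (1/6) ^ (a + 2)" if "es \<in> K a" for es a
  proof -
    obtain b where b: "b \<in> axis_walls a" "es \<in> walks (Suc a) b" "distinct es"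
      using \<open>es \<in> K a\<close> by (auto simp: K_def simp del: walks.simps)
    have "snd b \<in> dirs" using b(1) by (auto simp: axis_walls_def dirs_def)
    then have "a + 2 \<le> 4 * card (outer_sites es)"
      using card_outer_sites[OF b(3) snd_walks[OF b(2)]] length_walks[OF b(2)] by simp
    then have "(1/6::real) ^ (4 * card (outer_sites es)) \<le> (1/6) ^ (a + 2)"
      by (rule power_decreasing) auto
    with decay[OF finite_outer_sites Kne[OF that]] show ?thesis by simp
  qed
  have H_le: "prob (H a) \<le> 1/6 * (1/2) ^ a" for a
  proof -
    have "prob (H a) \<le> (\<Sum>es\<in>K a. prob (\<Inter>z\<in>outer_sites es. bad z))"
      unfolding H_def by (intro finite_measure_subadditive_finite finK) (use ev1 in auto)
    also have "\<dots> \<le> (\<Sum>es\<in>K a. (1/6) ^ (a + 2))"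
      by (intro sum_mono es_le)
    also have "\<dots> = real (card (K a)) * (1/6) ^ (a + 2)" by simp
    also have "\<dots> \<le> real (2 * 3 ^ Suc a) * (1/6) ^ (a + 2)"
      using cardK[of a] by (intro mult_right_mono) (simp_all only: of_nat_le_iff, simp)
    also have "\<dots> = 1/6 * (1/2) ^ a"
      by (simp add: power_divide field_simps flip: power_mult_distrib)
    finally show ?thesis .
  qed
  have sm: "summable (\<lambda>a. 1/6 * (1/2::real) ^ a)" by (intro summable_mult summable_geometric) auto
  have smH: "summable (\<lambda>a. prob (H a))"
    by (rule summable_comparison_test'[OF sm, of 0]) (use H_le in auto)
  have "prob (\<Union>a. H a) \<le> (\<Sum>a. prob (H a))"
    by (rule finite_measure_subadditive_countably[OF _ smH]) (use H in auto)
  also have "\<dots> \<le> (\<Sum>a. 1/6 * (1/2::real) ^ a)"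
    by (intro suminf_le smH sm H_le)
  also have "\<dots> = 1/3" by (subst suminf_mult) (auto simp: suminf_geometric)
  finally have "prob (\<Union>a. H a) \<le> 1/3" .
  moreover have "prob (bad (0, 0)) \<le> 1 / 1296"
    using decay[of "{(0,0)}"] by (simp add: power_divide)
  moreover have "prob (bad (0, 0) \<union> (\<Union>a. H a)) \<le> prob (bad (0, 0)) + prob (\<Union>a. H a)"
    by (intro measure_Un_le bad sets.countable_UN) (use H in auto)
  ultimately have lt1: "prob (bad (0, 0) \<union> (\<Union>a. H a)) < 1" by simp
  have evU: "bad (0, 0) \<union> (\<Union>a. H a) \<in> events"
    using bad H by (intro sets.Un sets.countable_UN) auto
  define G where "G = space M - (bad (0, 0) \<union> (\<Union>a. H a))"
  show thesis
  proof (rule that)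
    show "G \<in> events" using evU by (auto simp: G_def)
    show "prob G > 0" using prob_compl[OF evU] lt1 by (simp add: G_def)
    show "\<omega> \<notin> bad (0, 0)" if "\<omega> \<in> G" for \<omega> using that by (simp add: G_def)
    show "\<exists>u\<in>C. \<exists>d\<in>dirs. u + d \<notin> C \<and> \<omega> \<notin> bad (u + d)"
      if \<omega>: "\<omega> \<in> G" and C: "finite C" "(0, 0) \<in> C" for \<omega> C
    proof (rule ccontr)
      assume *: "\<not> ?thesis"
      obtain a b where b: "b \<in> axis_walls a" "\<And>i. (next_wall C ^^ i) b \<in> outer_boundary C"
        and inj: "inj_on (\<lambda>i. (next_wall C ^^ i) b) {..Suc a}"
        using exists_contour[OF C] by blast
      define es where "es = map (\<lambda>i. (next_wall C ^^ i) b) [0..<Suc (Suc a)]"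
      have "distinct es"
        using inj unfolding es_def distinct_map
        by (simp only: set_upt distinct_upt) (auto intro: inj_on_subset)
      moreover have "es \<in> walks (Suc a) b" unfolding es_def by (rule next_wall_walk)
      ultimately have "es \<in> K a" using b(1) unfolding K_def by blast
      moreover have "\<omega> \<in> (\<Inter>z\<in>outer_sites es. bad z)"
      proof
        fix z assume "z \<in> outer_sites es"
        then obtain i u d where "(next_wall C ^^ i) b = (u, d)" "z = u + d"
          unfolding outer_sites_def es_def by (auto simp del: upt_Suc) (metis surj_pair)
        with b(2)[of i] have "u \<in> C" "d \<in> dirs" "u + d \<notin> C" "z = u + d"
          by (auto simp: outer_boundary_def)
        with * show "\<omega> \<in> bad z" by blast
      qed
      ultimately have "\<omega> \<in> H a" unfolding H_def by blast
      with \<omega> show False by (auto simp: G_def)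
    qed
  qed
qed

end

section \<open>Measurability\<close>

lemma locally_finite_config:
  "\<Phi> \<in> measurable N config_space \<Longrightarrow> \<omega> \<in> space N \<Longrightarrow> locally_finite_set (\<Phi> \<omega>)"
  by (drule (1) measurable_space) (simp add: space_config_space)

lemma finite_config:
  "\<Phi> \<in> measurable N config_space \<Longrightarrow> \<omega> \<in> space N \<Longrightarrow> bounded B \<Longrightarrow> finite (\<Phi> \<omega> \<inter> B)"
  using locally_finite_config[of \<Phi> N \<omega>] by (simp add: locally_finite_set_def)

lemma measurable_card_config:
  assumes \<Phi>: "\<Phi> \<in> measurable N config_space" and B: "B \<in> sets borel" "bounded B"
  shows "(\<lambda>\<omega>. card (\<Phi> \<omega> \<inter> B)) \<in> measurable N (count_space UNIV)"
proof (rule measurable_compose[OF \<Phi>], rule measurable_count_space_eq2_countable[THEN iffD2], safe)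
  fix n
  have "(\<lambda>S. card (S \<inter> B)) -` {n} \<inter> space config_space = {S. locally_finite_set S \<and> card (S \<inter> B) = n}"
    by (auto simp: space_config_space)
  also have "\<dots> \<in> sets config_space"
    unfolding sets_config_space using B by (intro sigma_sets.Basic) auto
  finally show "(\<lambda>S. card (S \<inter> B)) -` {n} \<inter> space config_space \<in> sets config_space" .
qed auto

text \<open>Dynkin induction from measurable rectangles, where the count is an indicator times the
  count in a bounded Borel set. Boundedness of \<open>B\<close> keeps counts finite, so that
  complements can be treated by subtraction.\<close>

lemma measurable_card_section_config:
  fixes \<Phi> :: "'w \<Rightarrow> 'a::euclidean_space set"
  assumes \<Phi>: "\<Phi> \<in> measurable N config_space" and B: "B \<in> sets borel" "bounded B"
    and D: "D \<in> sets (borel \<Otimes>\<^sub>M N)"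
  shows "(\<lambda>\<omega>. ennreal (card {x \<in> \<Phi> \<omega> \<inter> B. (x, \<omega>) \<in> D})) \<in> borel_measurable N"
proof -
  let ?c = "\<lambda>D \<omega>. ennreal (card {x \<in> \<Phi> \<omega> \<inter> B. (x, \<omega>) \<in> D})"
  let ?G = "{a \<times> b |a b. a \<in> sets (borel :: 'a measure) \<and> b \<in> sets N}"
  note fin = finite_config[OF \<Phi> _ B(2)]
  have G: "Int_stable ?G" "?G \<subseteq> Pow (space borel \<times> space N)"
    using Int_stable_pair_measure_generator[of borel N] pair_measure_closed[of borel N] by auto
  have "D \<in> sigma_sets (space borel \<times> space N) ?G"
    using D by (simp add: sets_pair_measure)
  with G show ?thesis
  proof (induction D rule: sigma_sets_induct_disjoint)
    case (basic D)
    then obtain A W where D: "D = A \<times> W" "A \<in> sets borel" "W \<in> sets N" by auto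
    have "?c D = (\<lambda>\<omega>. indicator W \<omega> * ennreal (card (\<Phi> \<omega> \<inter> (A \<inter> B))))"
      by (auto simp: D fun_eq_iff indicator_def intro!: arg_cong[of _ _ card])
    moreover have "(\<lambda>\<omega>. card (\<Phi> \<omega> \<inter> (A \<inter> B))) \<in> measurable N (count_space UNIV)"
      using B D by (intro measurable_card_config[OF \<Phi>]) (auto intro: bounded_subset)
    ultimately show ?case using D by simp
  next
    case empty
    show ?case by simp
  next
    case (compl D)
    have "?c ((space borel \<times> space N) - D) \<omega> = ennreal (card (\<Phi> \<omega> \<inter> B)) - ?c D \<omega>"
      if "\<omega> \<in> space N" for \<omega>
    proof -
      have "{x \<in> \<Phi> \<omega> \<inter> B. (x, \<omega>) \<in> (space borel \<times> space N) - D}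
          = \<Phi> \<omega> \<inter> B - {x \<in> \<Phi> \<omega> \<inter> B. (x, \<omega>) \<in> D}" using that by auto
      moreover have "card (\<Phi> \<omega> \<inter> B - {x \<in> \<Phi> \<omega> \<inter> B. (x, \<omega>) \<in> D}) =
          card (\<Phi> \<omega> \<inter> B) - card {x \<in> \<Phi> \<omega> \<inter> B. (x, \<omega>) \<in> D}"
        using fin[OF that] by (intro card_Diff_subset) (auto intro: rev_finite_subset)
      moreover have "card {x \<in> \<Phi> \<omega> \<inter> B. (x, \<omega>) \<in> D} \<le> card (\<Phi> \<omega> \<inter> B)"
        using fin[OF that] by (intro card_mono) auto
      ultimately show ?thesis by (simp only: of_nat_diff ennreal_minus of_nat_0_le_iff)
    qed
    moreover have "(\<lambda>\<omega>. ennreal (card (\<Phi> \<omega> \<inter> B)) - ?c D \<omega>) \<in> borel_measurable N"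
      using compl measurable_card_config[OF \<Phi> B] by measurable
    ultimately show ?case by (simp cong: measurable_cong)
  next
    case (union D)
    have "?c (\<Union>i. D i) \<omega> = (\<Sum>i. ?c (D i) \<omega>)" if "\<omega> \<in> space N" for \<omega>
    proof -
      let ?A = "\<lambda>i. {x \<in> \<Phi> \<omega> \<inter> B. (x, \<omega>) \<in> D i}"
      have "(\<Sum>i. emeasure (count_space UNIV) (?A i)) = emeasure (count_space UNIV) (\<Union>i. ?A i)"
        using union(1) by (intro suminf_emeasure) (auto simp: disjoint_family_on_def)
      also have "(\<Union>i. ?A i) = {x \<in> \<Phi> \<omega> \<inter> B. (x, \<omega>) \<in> (\<Union>i. D i)}" by auto
      also have "emeasure (count_space UNIV) \<dots> = ?c (\<Union>i. D i) \<omega>"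
        using fin[OF that] by (subst emeasure_count_space_finite)
          (auto simp: ennreal_of_nat_eq_real_of_nat intro: rev_finite_subset)
      moreover have "emeasure (count_space UNIV) (?A i) = ?c (D i) \<omega>" for i
        using fin[OF that] by (subst emeasure_count_space_finite)
          (auto simp: ennreal_of_nat_eq_real_of_nat intro: rev_finite_subset)
      ultimately show ?thesis by simp
    qed
    moreover have "(\<lambda>\<omega>. \<Sum>i. ?c (D i) \<omega>) \<in> borel_measurable N"
      using union by measurable
    ultimately show ?case by (simp cong: measurable_cong)
  qed
qed

text \<open>The sum is written as an integral against counting measure, so that the standard
  induction for nonnegative measurable functions applies, with monotone convergence in the last
  case.\<close>

lemma measurable_sum_config:
  fixes \<Phi> :: "'w \<Rightarrow> 'a::euclidean_space set" and f :: "'a \<times> 'w \<Rightarrow> ennreal"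
  assumes \<Phi>: "\<Phi> \<in> measurable N config_space" and B: "B \<in> sets borel" "bounded B"
    and f: "f \<in> borel_measurable (borel \<Otimes>\<^sub>M N)"
  shows "(\<lambda>\<omega>. \<Sum>x\<in>\<Phi> \<omega> \<inter> B. f (x, \<omega>)) \<in> borel_measurable N"
proof -
  note fin = finite_config[OF \<Phi> _ B(2)]
  have "(\<lambda>\<omega>. \<integral>\<^sup>+x. f (x, \<omega>) \<partial>count_space (\<Phi> \<omega> \<inter> B)) \<in> borel_measurable N"
    using f
  proof (induction rule: borel_measurable_induct)
    case (cong f g)
    then show ?case
      by (simp add: space_pair_measure cong: measurable_cong nn_integral_cong)
  next
    case (set D)
    have "(\<integral>\<^sup>+x. indicator D (x, \<omega>) \<partial>count_space (\<Phi> \<omega> \<inter> B)) =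
        ennreal (card {x \<in> \<Phi> \<omega> \<inter> B. (x, \<omega>) \<in> D})" if "\<omega> \<in> space N" for \<omega>
      using fin[OF that]
      by (simp add: nn_integral_count_space_finite indicator_def sum.If_cases Int_def ennreal_of_nat_eq_real_of_nat)
    then show ?case
      using measurable_card_section_config[OF \<Phi> B set] by (simp cong: measurable_cong)
  next
    case (mult u c)
    then show ?case by (simp add: nn_integral_cmult)
  next
    case (add u v)
    then show ?case by (simp add: nn_integral_add)
  next
    case (seq U)
    have "(\<integral>\<^sup>+x. (SUP i. U i) (x, \<omega>) \<partial>count_space (\<Phi> \<omega> \<inter> B)) =
       (SUP i. \<integral>\<^sup>+x. U i (x, \<omega>) \<partial>count_space (\<Phi> \<omega> \<inter> B))" for \<omega>
      unfolding SUP_apply using \<open>incseq U\<close>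
      by (intro nn_integral_monotone_convergence_SUP) (auto simp: incseq_def le_fun_def)
    with seq show ?case by simp
  qed
  then show ?thesis
    using fin by (simp add: nn_integral_count_space_finite cong: measurable_cong)
qed

text \<open>Every finite subset of \<open>S\<close> lies in a ball of integer radius. The supremum
  over all finite subsets thus becomes one over a sequence whose index set does not depend on
  \<open>S\<close>, which preserves measurability.\<close>

lemma infsum_locally_finite:
  fixes f :: "'a::euclidean_space \<Rightarrow> ennreal"
  assumes "locally_finite_set S"
  shows "infsum f S = (SUP n::nat. \<Sum>x\<in>S \<inter> cball 0 (real n). f x)"
proof -
  have fin: "finite (S \<inter> cball 0 r)" for r
    using assms by (simp add: locally_finite_set_def)
  have "infsum f S = (SUP F\<in>{F. finite F \<and> F \<subseteq> S}. sum f F)"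
    by (rule nonneg_infsum_complete) simp
  also have "\<dots> = (SUP n::nat. \<Sum>x\<in>S \<inter> cball 0 (real n). f x)"
  proof (rule antisym; rule SUP_mono)
    fix F assume F: "F \<in> {F. finite F \<and> F \<subseteq> S}"
    then obtain r where r: "\<forall>x\<in>F. norm x \<le> r" using finite_imp_bounded[of F] by (auto simp: bounded_iff)
    obtain n :: nat where "r \<le> real n" using real_arch_simple by blast
    with r F have "F \<subseteq> S \<inter> cball 0 (real n)" by force
    then show "\<exists>n\<in>UNIV. sum f F \<le> (\<Sum>x\<in>S \<inter> cball 0 (real n). f x)"
      using fin by (intro bexI[of _ n] sum_mono2) auto
  next
    fix n :: nat
    show "\<exists>F\<in>{F. finite F \<and> F \<subseteq> S}. (\<Sum>x\<in>S \<inter> cball 0 (real n). f x) \<le> sum f F"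
      using fin by (intro bexI[of _ "S \<inter> cball 0 (real n)"]) auto
  qed
  finally show ?thesis .
qed

lemma measurable_infsum_config:
  fixes \<Phi> :: "'w \<Rightarrow> 'a::euclidean_space set" and f :: "'a \<times> 'w \<Rightarrow> ennreal"
  assumes \<Phi>: "\<Phi> \<in> measurable N config_space" and f: "f \<in> borel_measurable (borel \<Otimes>\<^sub>M N)"
  shows "(\<lambda>\<omega>. \<Sum>\<^sub>\<infinity>x\<in>\<Phi> \<omega>. f (x, \<omega>)) \<in> borel_measurable N"
proof -
  have "(\<lambda>\<omega>. SUP n::nat. \<Sum>x\<in>\<Phi> \<omega> \<inter> cball 0 (real n). f (x, \<omega>)) \<in> borel_measurable N"
    by (intro borel_measurable_SUP measurable_sum_config[OF \<Phi> _ _ f]) auto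
  then show ?thesis
    by (simp add: infsum_locally_finite locally_finite_config[OF \<Phi>] cong: measurable_cong)
qed

text \<open>A quantifier over random points becomes countable: a point with the property exists iff
  the sum of indicators over some ball of integer radius is nonzero.\<close>

lemma pred_Bex_config:
  fixes \<Phi> :: "'w \<Rightarrow> 'a::euclidean_space set"
  assumes \<Phi>: "\<Phi> \<in> measurable N config_space"
    and P: "Measurable.pred (borel \<Otimes>\<^sub>M N) (\<lambda>z. P (fst z) (snd z))"
  shows "Measurable.pred N (\<lambda>\<omega>. \<exists>x\<in>\<Phi> \<omega>. P x \<omega>)"
proof -
  let ?f = "\<lambda>z. of_bool (P (fst z) (snd z)) :: ennreal"
  have f: "?f \<in> borel_measurable (borel \<Otimes>\<^sub>M N)" using P by measurable
  have "(\<exists>x\<in>\<Phi> \<omega>. P x \<omega>) \<longleftrightarrow> (\<exists>n::nat. (\<Sum>x\<in>\<Phi> \<omega> \<inter> cball 0 (real n). ?f (x, \<omega>)) \<noteq> 0)"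
    if "\<omega> \<in> space N" for \<omega>
  proof -
    have fin: "finite (\<Phi> \<omega> \<inter> cball 0 r)" for r
      using that by (intro finite_config[OF \<Phi>]) auto
    have "\<exists>n::nat. x \<in> cball 0 (real n)" for x :: 'a
      using real_arch_simple[of "norm x"] by simp
    then show ?thesis by (simp add: sum_eq_0_iff[OF fin] Bex_def) blast
  qed
  moreover have "Measurable.pred N (\<lambda>\<omega>. \<exists>n::nat. (\<Sum>x\<in>\<Phi> \<omega> \<inter> cball 0 (real n). ?f (x, \<omega>)) \<noteq> 0)"
  proof (rule pred_intros_countable)
    fix n :: nat
    have [measurable]: "(\<lambda>\<omega>. \<Sum>x\<in>\<Phi> \<omega> \<inter> cball 0 (real n). ?f (x, \<omega>)) \<in> borel_measurable N"
      by (rule measurable_sum_config[OF \<Phi> _ _ f]) auto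
    show "Measurable.pred N (\<lambda>\<omega>. (\<Sum>x\<in>\<Phi> \<omega> \<inter> cball 0 (real n). ?f (x, \<omega>)) \<noteq> 0)"
      by measurable
  qed
  ultimately show ?thesis by (simp cong: measurable_cong)
qed

lemma pred_Ball_config:
  fixes \<Phi> :: "'w \<Rightarrow> 'a::euclidean_space set"
  assumes \<Phi>: "\<Phi> \<in> measurable N config_space"
    and P: "Measurable.pred (borel \<Otimes>\<^sub>M N) (\<lambda>z. P (fst z) (snd z))"
  shows "Measurable.pred N (\<lambda>\<omega>. \<forall>x\<in>\<Phi> \<omega>. P x \<omega>)"
proof -
  have "Measurable.pred N (\<lambda>\<omega>. \<not> (\<exists>x\<in>\<Phi> \<omega>. \<not> P x \<omega>))"
    by (rule pred_intros_logic(2), rule pred_Bex_config[OF \<Phi>], rule pred_intros_logic(2), rule P)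
  then show ?thesis by simp
qed

lemma pred_Bex_insert_config:
  fixes \<Phi> :: "'w \<Rightarrow> 'a::euclidean_space set"
  assumes \<Phi>: "\<Phi> \<in> measurable N config_space"
    and P: "Measurable.pred (borel \<Otimes>\<^sub>M N) (\<lambda>z. P (fst z) (snd z))"
  shows "Measurable.pred N (\<lambda>\<omega>. \<exists>x\<in>insert p (\<Phi> \<omega>). P x \<omega>)"
proof -
  have "Measurable.pred N (\<lambda>\<omega>. P p \<omega>)"
    using measurable_compose[OF measurable_Pair1'[of p borel N] P] by simp
  moreover note pred_Bex_config[OF assms]
  ultimately show ?thesis by simp
qed

text \<open>Excluded points get the summand 0, so that the sum runs over
  \<open>\<Phi> \<omega>\<close> itself. The point \<open>p\<close> is split off and also set to 0
  in the remaining sum, since \<open>\<Phi> \<omega>\<close> may already contain it.\<close>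

lemma measurable_infsum_insert_Diff:
  fixes \<Phi> :: "'w \<Rightarrow> 'a::euclidean_space set" and f :: "'a \<times> 'w \<Rightarrow> ennreal"
  assumes \<Phi>: "\<Phi> \<in> measurable N config_space"
    and f[measurable]: "f \<in> borel_measurable (borel \<Otimes>\<^sub>M N)"
    and A[measurable]: "Measurable.pred (borel \<Otimes>\<^sub>M N) (\<lambda>z. fst z \<in> A (snd z))"
  shows "(\<lambda>\<omega>. \<Sum>\<^sub>\<infinity>x\<in>insert p (\<Phi> \<omega>) - A \<omega>. f (x, \<omega>)) \<in> borel_measurable N"
proof -
  let ?g = "\<lambda>z. if fst z \<in> A (snd z) \<or> fst z = p then 0 else f z"
  have eq: "(\<Sum>\<^sub>\<infinity>x\<in>insert p (\<Phi> \<omega>) - A \<omega>. f (x, \<omega>)) =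
      (if p \<in> A \<omega> then 0 else f (p, \<omega>)) + (\<Sum>\<^sub>\<infinity>x\<in>\<Phi> \<omega>. ?g (x, \<omega>))" for \<omega>
  proof -
    have "(\<Sum>\<^sub>\<infinity>x\<in>\<Phi> \<omega> - insert p (A \<omega>). f (x, \<omega>)) = (\<Sum>\<^sub>\<infinity>x\<in>\<Phi> \<omega>. ?g (x, \<omega>))"
      by (rule infsum_cong_neutral) auto
    moreover have "insert p (\<Phi> \<omega>) - A \<omega> = \<Phi> \<omega> - insert p (A \<omega>)" if "p \<in> A \<omega>"
      using that by auto
    moreover have "(\<Sum>\<^sub>\<infinity>x\<in>insert p (\<Phi> \<omega>) - A \<omega>. f (x, \<omega>))
        = f (p, \<omega>) + (\<Sum>\<^sub>\<infinity>x\<in>\<Phi> \<omega> - insert p (A \<omega>). f (x, \<omega>))" if "p \<notin> A \<omega>"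
    proof -
      have *: "insert p (\<Phi> \<omega>) - A \<omega> = insert p (\<Phi> \<omega> - insert p (A \<omega>))" using that by auto
      show ?thesis unfolding * by (rule infsum_insert) (auto intro: nonneg_summable_on_complete)
    qed
    ultimately show ?thesis by auto
  qed
  have pp: "(\<lambda>\<omega>. (p, \<omega>)) \<in> measurable N (borel \<Otimes>\<^sub>M N)" by simp
  have [measurable]: "Measurable.pred N (\<lambda>\<omega>. p \<in> A \<omega>)" "(\<lambda>\<omega>. f (p, \<omega>)) \<in> borel_measurable N"
    using measurable_compose[OF pp A] measurable_compose[OF pp f] by simp_all
  have "?g \<in> borel_measurable (borel \<Otimes>\<^sub>M N)" by measurable
  from measurable_infsum_config[OF \<Phi> this]
  have [measurable]: "(\<lambda>\<omega>. \<Sum>\<^sub>\<infinity>x\<in>\<Phi> \<omega>. ?g (x, \<omega>)) \<in> borel_measurable N" .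
  show ?thesis unfolding eq by measurable
qed

section \<open>Measurability of the event of an infinite out-component\<close>

context
  fixes l :: "real \<Rightarrow> real" and \<gamma> :: real and N :: "'w measure"
    and \<Phi> \<Phi>E :: "'w \<Rightarrow> 'a::euclidean_space set"
  assumes l: "(\<lambda>r. l \<bar>r\<bar>) \<in> borel_measurable borel"
    and \<Phi>[measurable]: "\<Phi> \<in> measurable N config_space"
    and \<Phi>E[measurable]: "\<Phi>E \<in> measurable N config_space"
begin

text \<open>The attenuation is arbitrary on negative reals, so measurability is assumed for
  \<open>l \<bar>r\<bar>\<close>; for distances the absolute value disappears.\<close>

private lemma l_dist: "(\<lambda>z. ennreal (l (dist (f z) (g z)))) \<in> borel_measurable K"
  if [measurable]: "f \<in> borel_measurable K" "g \<in> borel_measurable K" for f g :: "'c \<Rightarrow> 'a" and K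
proof -
  have "(\<lambda>z. l \<bar>dist (f z) (g z)\<bar>) \<in> borel_measurable K"
    by (rule measurable_compose[OF _ l]) measurable
  then show ?thesis by simp
qed

text \<open>Measurability is joint in both end points and \<open>\<omega>\<close>, because the end
  points are later quantified over the random configuration.\<close>

lemma pred_ssg_edges:
  "Measurable.pred (borel \<Otimes>\<^sub>M borel \<Otimes>\<^sub>M N)
     (\<lambda>(x, y, \<omega>). (x, y) \<in> ssg_edges l \<gamma> (insert 0 (\<Phi> \<omega>)) (\<Phi>E \<omega>))"
proof -
  let ?Q = "borel \<Otimes>\<^sub>M borel \<Otimes>\<^sub>M N :: ('a \<times> 'a \<times> 'w) measure"
  have P[measurable]: "(\<lambda>q. \<Phi> (snd (snd q))) \<in> measurable ?Q config_space"
    and PE: "(\<lambda>q. \<Phi>E (snd (snd q))) \<in> measurable ?Q config_space" by measurable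
  have mem: "Measurable.pred ?Q (\<lambda>q. \<exists>z\<in>insert 0 (\<Phi> (snd (snd q))). z = g q)"
    if [measurable]: "g \<in> borel_measurable ?Q" for g
    by (rule pred_Bex_insert_config[OF P]) measurable
  have node: "(\<lambda>q. sinr_node l \<gamma> (insert 0 (\<Phi> (snd (snd q)))) (fst q) (fst (snd q))) \<in> borel_measurable ?Q"
  proof -
    have "(\<lambda>q. \<Sum>\<^sub>\<infinity>z\<in>insert 0 (\<Phi> (snd (snd q))) - {fst q, fst (snd q)}.
        (\<lambda>(z, q). ennreal (l (dist z (fst (snd q))))) (z, q)) \<in> borel_measurable ?Q"
      by (rule measurable_infsum_insert_Diff[OF P]) (simp_all add: split_beta l_dist)
    moreover have "(\<lambda>q. ennreal (l (dist (fst q) (fst (snd q))))) \<in> borel_measurable ?Q"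
      by (rule l_dist) measurable
    ultimately show ?thesis unfolding sinr_node_def by simp
  qed
  let ?R = "borel \<Otimes>\<^sub>M ?Q"
  have PR: "(\<lambda>r. \<Phi> (snd (snd (snd r)))) \<in> measurable ?R config_space" by measurable
  have eav: "(\<lambda>r. sinr_eavesdropper l (insert 0 (\<Phi> (snd (snd (snd r))))) (fst (snd r)) (fst r)) \<in> borel_measurable ?R"
  proof -
    have "(\<lambda>r. \<Sum>\<^sub>\<infinity>z\<in>insert 0 (\<Phi> (snd (snd (snd r)))) - {fst (snd r)}.
        (\<lambda>(z, r). ennreal (l (dist z (fst r)))) (z, r)) \<in> borel_measurable ?R"
      by (rule measurable_infsum_insert_Diff[OF PR]) (simp_all add: split_beta l_dist)
    moreover have "(\<lambda>r. ennreal (l (dist (fst (snd r)) (fst r)))) \<in> borel_measurable ?R"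
      by (rule l_dist) measurable
    ultimately show ?thesis unfolding sinr_eavesdropper_def by simp
  qed
  have "Measurable.pred ?Q (\<lambda>q. \<forall>e\<in>\<Phi>E (snd (snd q)).
      sinr_node l \<gamma> (insert 0 (\<Phi> (snd (snd q)))) (fst q) (fst (snd q)) >
      sinr_eavesdropper l (insert 0 (\<Phi> (snd (snd q)))) (fst q) e)"
  proof (rule pred_Ball_config[OF PE])
    note [measurable] = eav measurable_compose[OF measurable_snd node]
    show "Measurable.pred ?R (\<lambda>z.
      sinr_node l \<gamma> (insert 0 (\<Phi> (snd (snd (snd z))))) (fst (snd z)) (fst (snd (snd z))) >
      sinr_eavesdropper l (insert 0 (\<Phi> (snd (snd (snd z))))) (fst (snd z)) (fst z))"
      by measurable
  qed
  moreover have "Measurable.pred ?Q (\<lambda>q. fst q \<noteq> fst (snd q))" by measurable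
  moreover have "Measurable.pred ?Q (\<lambda>q. \<exists>z\<in>insert 0 (\<Phi> (snd (snd q))). z = fst q)"
    "Measurable.pred ?Q (\<lambda>q. \<exists>z\<in>insert 0 (\<Phi> (snd (snd q))). z = fst (snd q))"
    by (rule mem, measurable)+
  ultimately have "Measurable.pred ?Q (\<lambda>q. (\<exists>z\<in>insert 0 (\<Phi> (snd (snd q))). z = fst q) \<and>
    (\<exists>z\<in>insert 0 (\<Phi> (snd (snd q))). z = fst (snd q)) \<and> fst q \<noteq> fst (snd q) \<and> (\<forall>e\<in>\<Phi>E (snd (snd q)).
      sinr_node l \<gamma> (insert 0 (\<Phi> (snd (snd q)))) (fst q) (fst (snd q)) >
      sinr_eavesdropper l (insert 0 (\<Phi> (snd (snd q)))) (fst q) e))"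
    by (intro pred_intros_logic(3))
  then show ?thesis by (simp add: ssg_edges_def split_beta)
qed

text \<open>Induction on the path length; the last intermediate node is quantified over the
  configuration by \<open>pred_Bex_insert_config\<close>.\<close>

lemma pred_ssg_reach:
  "Measurable.pred (borel \<Otimes>\<^sub>M N)
     (\<lambda>z. (0, fst z) \<in> ssg_edges l \<gamma> (insert 0 (\<Phi> (snd z))) (\<Phi>E (snd z)) ^^ n)"
proof (induction n)
  case 0
  have "Measurable.pred (borel \<Otimes>\<^sub>M N) (\<lambda>z. fst z = (0 :: 'a))" by measurable
  moreover have "(\<lambda>z. (0, fst z) \<in> ssg_edges l \<gamma> (insert 0 (\<Phi> (snd z))) (\<Phi>E (snd z)) ^^ 0)
      = (\<lambda>z. fst z = (0 :: 'a))" by auto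
  ultimately show ?case by (simp only:)
next
  case (Suc n)
  let ?E = "\<lambda>\<omega>. ssg_edges l \<gamma> (insert 0 (\<Phi> \<omega>)) (\<Phi>E \<omega>)"
  let ?Q = "borel \<Otimes>\<^sub>M N :: ('a \<times> 'w) measure"
  have "Measurable.pred ?Q (\<lambda>q. \<exists>x\<in>insert 0 (\<Phi> (snd q)). (0, x) \<in> ?E (snd q) ^^ n \<and> (x, fst q) \<in> ?E (snd q))"
  proof (rule pred_Bex_insert_config)
    have "(\<lambda>z. (fst z, snd (snd z))) \<in> measurable (borel \<Otimes>\<^sub>M ?Q) ?Q" by measurable
    from measurable_compose[OF this Suc.IH]
    show "Measurable.pred (borel \<Otimes>\<^sub>M ?Q)
        (\<lambda>z. (0, fst z) \<in> ?E (snd (snd z)) ^^ n \<and> (fst z, fst (snd z)) \<in> ?E (snd (snd z)))"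
      using pred_ssg_edges by (intro pred_intros_logic(3)) (simp_all add: case_prod_unfold)
  qed measurable
  moreover have "(0, fst q) \<in> ?E (snd q) ^^ Suc n \<longleftrightarrow>
      (\<exists>x\<in>insert 0 (\<Phi> (snd q)). (0, x) \<in> ?E (snd q) ^^ n \<and> (x, fst q) \<in> ?E (snd q))" for q
    by (auto simp: ssg_edges_def relcomp_unfold)
  ultimately show ?case by (simp del: relpow.simps insert_iff)
qed

text \<open>By local finiteness a component is finite iff it is bounded. So it is infinite iff nodes
  of arbitrarily large norm are reachable, which needs only countable quantifiers and quantifiers
  over the configuration.\<close>

lemma sets_infinite_out_component:
  "{\<omega> \<in> space N. infinite (out_component l \<gamma> (insert 0 (\<Phi> \<omega>)) (\<Phi>E \<omega>) 0)} \<in> sets N"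
proof -
  let ?E = "\<lambda>\<omega>. ssg_edges l \<gamma> (insert 0 (\<Phi> \<omega>)) (\<Phi>E \<omega>)"
  have "infinite (out_component l \<gamma> (insert 0 (\<Phi> \<omega>)) (\<Phi>E \<omega>) 0) \<longleftrightarrow>
     (\<forall>k::nat. \<exists>y\<in>insert 0 (\<Phi> \<omega>). norm y > real k \<and> (\<exists>n. (0, y) \<in> ?E \<omega> ^^ n))"
    if "\<omega> \<in> space N" for \<omega>
  proof -
    let ?C = "out_component l \<gamma> (insert 0 (\<Phi> \<omega>)) (\<Phi>E \<omega>) 0"
    have "finite ?C \<longleftrightarrow> bounded ?C"
    proof
      assume "bounded ?C"
      then have "finite (insert 0 (\<Phi> \<omega> \<inter> ?C))" using finite_config[OF \<Phi> that] by blast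
      then show "finite ?C" by (rule rev_finite_subset) (auto simp: out_component_def)
    qed (rule finite_imp_bounded)
    also have "\<dots> \<longleftrightarrow> (\<exists>k::nat. \<forall>y\<in>?C. norm y \<le> real k)"
      unfolding bounded_iff by (meson order_trans real_arch_simple)
    finally show ?thesis
      by (simp add: out_component_def rtrancl_power not_le Bex_def conj_commute)
         (meson not_le)
  qed
  moreover have "Measurable.pred N (\<lambda>\<omega>. \<forall>k::nat. \<exists>y\<in>insert 0 (\<Phi> \<omega>). norm y > real k \<and> (\<exists>n. (0, y) \<in> ?E \<omega> ^^ n))"
  proof (rule pred_intros_countable(1), rule pred_Bex_insert_config[OF \<Phi>])
    fix k :: nat
    have "Measurable.pred (borel \<Otimes>\<^sub>M N) (\<lambda>z. \<exists>n. (0, fst z) \<in> ?E (snd z) ^^ n)"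
      by (rule pred_intros_countable(2)) (rule pred_ssg_reach)
    moreover have "Measurable.pred (borel \<Otimes>\<^sub>M N) (\<lambda>z. norm (fst z :: 'a) > real k)" by measurable
    ultimately show "Measurable.pred (borel \<Otimes>\<^sub>M N)
        (\<lambda>z. norm (fst z) > real k \<and> (\<exists>n. (0, fst z) \<in> ?E (snd z) ^^ n))"
      by (intro pred_intros_logic(3))
  qed
  ultimately show ?thesis
    by (simp add: pred_def cong: conj_cong)
qed

end

section \<open>Exponential moments of Poisson counts\<close>

lemma nn_integral_nat_valued:
  fixes K :: "'a \<Rightarrow> nat"
  assumes [measurable]: "K \<in> measurable M (count_space UNIV)"
  shows "(\<integral>\<^sup>+\<omega>. g (K \<omega>) \<partial>M) = (\<Sum>n. g n * emeasure M {\<omega> \<in> space M. K \<omega> = n})"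
proof -
  have "g (K \<omega>) = (\<Sum>n. g n * indicator {\<omega> \<in> space M. K \<omega> = n} \<omega>)" if "\<omega> \<in> space M" for \<omega>
    using that by (subst suminf_finite[of "{K \<omega>}"]) auto
  then have "(\<integral>\<^sup>+\<omega>. g (K \<omega>) \<partial>M) = (\<integral>\<^sup>+\<omega>. (\<Sum>n. g n * indicator {\<omega> \<in> space M. K \<omega> = n} \<omega>) \<partial>M)"
    by (rule nn_integral_cong)
  also have "\<dots> = (\<Sum>n. \<integral>\<^sup>+\<omega>. g n * indicator {\<omega> \<in> space M. K \<omega> = n} \<omega> \<partial>M)"
    by (rule nn_integral_suminf) measurable
  also have "\<dots> = (\<Sum>n. g n * emeasure M {\<omega> \<in> space M. K \<omega> = n})"
    by (simp add: nn_integral_cmult_indicator)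
  finally show ?thesis .
qed

text \<open>Here \<open>b\<close> switches on a penalty \<open>\<theta>\<close> for an empty square.\<close>

lemma (in prob_space) poisson_exp_moment:
  fixes K :: "'a \<Rightarrow> nat" and \<mu> c \<theta> :: real
  assumes K: "K \<in> measurable M (count_space UNIV)"
    and P: "\<And>n. prob {\<omega> \<in> space M. K \<omega> = n} = \<mu> ^ n / fact n * exp (- \<mu>)"
    and \<mu>: "\<mu> \<ge> 0" and c: "c \<ge> 0"
  shows "(\<integral>\<^sup>+\<omega>. ennreal (exp (c * K \<omega> + (if b \<and> K \<omega> = 0 then \<theta> else 0))) \<partial>M)
     \<le> ennreal (exp (\<mu> * (c * exp c) + (if b then exp (\<theta> - \<mu>) else 0)))"
proof -
  define g where "g n = exp (c * real n + (if b \<and> n = 0 then \<theta> else 0)) * (\<mu> ^ n / fact n * exp (- \<mu>))" for n :: nat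
  \<comment> \<open>At \<open>n = 0\<close> the penalised term is added to the unpenalised one
    instead of replacing it. The bound then splits into a constant and a full exponential
    series.\<close>
  define h where "h n = (if n = 0 then (if b then exp (\<theta> - \<mu>) else 0) else 0) + (\<mu> * exp c) ^ n /\<^sub>R fact n * exp (- \<mu>)" for n :: nat
  have gh: "g n \<le> h n" for n
    using \<mu> by (auto simp: g_def h_def exp_diff exp_minus power_mult_distrib exp_of_nat_mult[symmetric] mult.commute field_simps)
  have h: "h sums ((if b then exp (\<theta> - \<mu>) else 0) + exp (\<mu> * exp c) * exp (- \<mu>))"
    unfolding h_def
    using sums_If_finite_set[of "{0::nat}" "\<lambda>_. if b then exp (\<theta> - \<mu>) else 0"] 
    by (intro sums_add sums_mult2 exp_converges) simp
  have g0: "g n \<ge> 0" for n using \<mu> by (simp add: g_def)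
  have sg: "summable g"
    using summable_comparison_test'[OF sums_summable[OF h], of 0 g] gh g0 by simp
  have "(\<integral>\<^sup>+\<omega>. ennreal (exp (c * K \<omega> + (if b \<and> K \<omega> = 0 then \<theta> else 0))) \<partial>M) = (\<Sum>n. ennreal (g n))"
    by (subst nn_integral_nat_valued[OF K]) 
       (simp add: g_def emeasure_eq_measure P \<mu> flip: ennreal_mult'')
  also have "\<dots> = ennreal (suminf g)"
    by (rule suminf_ennreal2) (use g0 sg in auto)
  also have "\<dots> \<le> ennreal (suminf h)"
    using gh sg sums_summable[OF h] by (intro ennreal_leI suminf_le)
  also have "suminf h = (if b then exp (\<theta> - \<mu>) else 0) + exp (\<mu> * (exp c - 1))"
    using sums_unique[OF h] by (simp add: exp_add[symmetric] algebra_simps)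
  also have "\<dots> \<le> exp (\<mu> * (c * exp c) + (if b then exp (\<theta> - \<mu>) else 0))" (is "?B + ?A \<le> _")
  proof -
    have "1 - c \<le> exp (- c)" using exp_ge_add_one_self[of "- c"] by simp
    then have "(1 - c) * exp c \<le> exp (- c) * exp c" by (rule mult_right_mono) simp
    then have "exp c - 1 \<le> c * exp c" by (simp add: exp_minus algebra_simps)
    then have "?A \<le> exp (\<mu> * (c * exp c))" using \<mu> by (simp add: mult_left_mono)
    moreover have "?A \<ge> 1" using \<mu> c by simp
    moreover have "?B \<ge> 0" by simp
    \<comment> \<open>Turning the sum into a product puts the bound in the form \<open>exp\<close>
      of a sum, so that the bounds for independent squares combine by adding exponents.\<close>
    moreover have *: "B + A \<le> E * exp B" if "A \<le> E" "A \<ge> 1" "B \<ge> 0" for A B E :: real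
    proof -
      have "B + A \<le> E * (1 + B)"
        using that mult_right_mono[of 1 E B] by (simp add: algebra_simps)
      also have "\<dots> \<le> E * exp B"
        using that by (intro mult_left_mono exp_ge_add_one_self) simp
      finally show ?thesis .
    qed
    ultimately have "?B + ?A \<le> exp (\<mu> * (c * exp c)) * exp ?B" by (intro *)
    then show ?thesis by (simp only: exp_add)
  qed
  finally show ?thesis by (simp add: ennreal_leI)
qed

section \<open>The partition of the plane into squares\<close>

definition square :: "real \<Rightarrow> int \<times> int \<Rightarrow> (real ^ 2) set" where
  "square s u = {x. s * real_of_int (fst u) \<le> x $ 1 \<and> x $ 1 < s * (real_of_int (fst u) + 1) \<and> s * real_of_int (snd u) \<le> x $ 2 \<and> x $ 2 < s * (real_of_int (snd u) + 1)}"

lemma square_borel [measurable]: "square s u \<in> sets borel"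
  unfolding square_def by measurable

lemma square_subset_cbox:
  "square s u \<subseteq> cbox (vector [s * real_of_int (fst u), s * real_of_int (snd u)]) (vector [s * (real_of_int (fst u) + 1), s * (real_of_int (snd u) + 1)])"
  by (auto simp: square_def mem_box_cart forall_2)

lemma box_subset_square:
  "box (vector [s * real_of_int (fst u), s * real_of_int (snd u)]) (vector [s * (real_of_int (fst u) + 1), s * (real_of_int (snd u) + 1)]) \<subseteq> square s u"
  by (auto simp: square_def mem_box_cart forall_2)

lemma bounded_square: "bounded (square s u)"
  using bounded_cbox square_subset_cbox by (rule bounded_subset)

text \<open>The half-open square lies between an open and a closed box of the same measure.\<close>

lemma measure_square:
  assumes "s > 0"
  shows "measure lborel (square s u) = s ^ 2"
proof -
  let ?a = "vector [s * real_of_int (fst u), s * real_of_int (snd u)] :: real ^ 2" and ?b = "vector [s * (real_of_int (fst u) + 1), s * (real_of_int (snd u) + 1)] :: real ^ 2"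
  have "measure lborel (cbox ?a ?b) = s ^ 2"
  proof -
    have "?a \<in> cbox ?a ?b" using assms by (simp add: mem_box_cart forall_2)
    then have "measure lborel (cbox ?a ?b) = (\<Prod>i\<in>UNIV. ?b $ i - ?a $ i)"
      by (intro content_cbox_cart) blast
    then show ?thesis by (simp add: UNIV_2 algebra_simps power2_eq_square)
  qed
  moreover have "measure lborel (box ?a ?b) = measure lborel (cbox ?a ?b)"
    by (simp only: measure_lborel_box_eq measure_lborel_cbox_eq)
  moreover have "measure lborel (box ?a ?b) \<le> measure lborel (square s u)"
    using emeasure_bounded_finite[OF bounded_square[of s u]]
    by (intro measure_mono_fmeasurable box_subset_square) (auto simp: fmeasurable_def)
  moreover have "measure lborel (square s u) \<le> measure lborel (cbox ?a ?b)"
    using emeasure_bounded_finite[OF bounded_cbox]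
    by (intro measure_mono_fmeasurable square_subset_cbox) (auto simp: fmeasurable_def)
  ultimately show ?thesis by simp
qed

definition square_index :: "real \<Rightarrow> real ^ 2 \<Rightarrow> int \<times> int" where
  "square_index s x = (\<lfloor>x $ 1 / s\<rfloor>, \<lfloor>x $ 2 / s\<rfloor>)"

lemma mem_square_iff:
  assumes "s > 0"
  shows "x \<in> square s u \<longleftrightarrow> square_index s x = u"
  using assms by (cases u) (auto simp: square_def square_index_def floor_eq_iff field_simps)

lemma square_nonempty:
  assumes "s > 0"
  shows "square s u \<noteq> {}"
  using box_subset_square[of s u] assms
  by (auto simp: mem_box_cart square_def intro!: exI[of _ "vector [s * real_of_int (fst u), s * real_of_int (snd u)]"])

lemma inj_square: "s > 0 \<Longrightarrow> inj (square s)"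
  using square_nonempty by (intro injI) (metis mem_square_iff ex_in_conv)

text \<open>Counts in different squares are independent, so the exponential moment factorises and
  \<open>poisson_exp_moment\<close> bounds each factor.\<close>

lemma poisson_squares_exp_moment:
  fixes \<Phi> :: "'w \<Rightarrow> (real ^ 2) set" and c :: "int \<times> int \<Rightarrow> real" and \<theta> :: real
  assumes ppp: "poisson_point_process M lam \<Phi>" and lam: "lam \<ge> 0" and s: "s > 0"
    and F: "finite F" and c: "\<And>u. c u \<ge> 0"
  shows "(\<integral>\<^sup>+\<omega>. ennreal (exp (\<Sum>u\<in>F. c u * card (\<Phi> \<omega> \<inter> square s u)
        + (if u \<in> S \<and> card (\<Phi> \<omega> \<inter> square s u) = 0 then \<theta> else 0))) \<partial>M)
     \<le> ennreal (exp (\<Sum>u\<in>F. lam * s\<^sup>2 * (c u * exp (c u)) + (if u \<in> S then exp (\<theta> - lam * s\<^sup>2) else 0)))"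
proof -
  interpret prob_space M using ppp by (simp add: poisson_point_process_def)
  let ?Q = "square s"
  \<comment> \<open>Independence in \<open>poisson_point_process\<close> is indexed by the sets
    themselves; \<open>inv ?Q\<close> recovers the site from its square.\<close>
  define Y where "Y B n = ennreal (exp (c (inv ?Q B) * real n
    + (if inv ?Q B \<in> S \<and> n = 0 then \<theta> else 0)))" for B and n :: nat
  have inv: "inv ?Q (?Q u) = u" for u using inj_square[OF s] by simp
  have inj: "inj_on ?Q F" using inj_square[OF s] by (rule inj_on_subset) simp
  have disj: "disjoint (?Q ` F)"
    by (auto simp: disjoint_def mem_square_iff[OF s])
  have "indep_vars (\<lambda>_. count_space UNIV) (\<lambda>B \<omega>. card (\<Phi> \<omega> \<inter> B)) (?Q ` F)"
    using ppp disj F by (auto simp: poisson_point_process_def bounded_square)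
  then have indep: "indep_vars (\<lambda>_. borel) (\<lambda>B \<omega>. Y B (card (\<Phi> \<omega> \<inter> B))) (?Q ` F)"
    by (rule indep_vars_compose2) simp
  have "(\<integral>\<^sup>+\<omega>. ennreal (exp (\<Sum>u\<in>F. c u * card (\<Phi> \<omega> \<inter> ?Q u)
        + (if u \<in> S \<and> card (\<Phi> \<omega> \<inter> ?Q u) = 0 then \<theta> else 0))) \<partial>M)
      = (\<integral>\<^sup>+\<omega>. (\<Prod>B\<in>?Q ` F. Y B (card (\<Phi> \<omega> \<inter> B))) \<partial>M)"
    by (simp add: prod.reindex[OF inj] Y_def inv exp_sum[OF F] prod_ennreal)
  also have "\<dots> = (\<Prod>B\<in>?Q ` F. \<integral>\<^sup>+\<omega>. Y B (card (\<Phi> \<omega> \<inter> B)) \<partial>M)"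
    using F indep by (intro indep_vars_nn_integral) auto
  also have "\<dots> = (\<Prod>u\<in>F. \<integral>\<^sup>+\<omega>. Y (?Q u) (card (\<Phi> \<omega> \<inter> ?Q u)) \<partial>M)"
    by (simp add: prod.reindex[OF inj])
  also have "\<dots> \<le> (\<Prod>u\<in>F. ennreal (exp (lam * s\<^sup>2 * (c u * exp (c u)) + (if u \<in> S then exp (\<theta> - lam * s\<^sup>2) else 0))))"
  proof (rule prod_mono_ennreal)
    fix u assume "u \<in> F"
    have K: "(\<lambda>\<omega>. card (\<Phi> \<omega> \<inter> ?Q u)) \<in> measurable M (count_space UNIV)"
      using ppp by (intro measurable_card_config) (auto simp: poisson_point_process_def bounded_square)
    have P: "prob {\<omega> \<in> space M. card (\<Phi> \<omega> \<inter> ?Q u) = n} = (lam * s\<^sup>2) ^ n / fact n * exp (- (lam * s\<^sup>2))" for n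
    proof -
      have "B \<in> sets borel \<Longrightarrow> bounded B \<Longrightarrow> prob {\<omega> \<in> space M. card (\<Phi> \<omega> \<inter> B) = n}
          = (lam * measure lborel B) ^ n / fact n * exp (- (lam * measure lborel B))" for B
        using ppp unfolding poisson_point_process_def by blast
      from this[OF square_borel bounded_square] show ?thesis by (simp only: measure_square[OF s])
    qed
    show "(\<integral>\<^sup>+\<omega>. Y (?Q u) (card (\<Phi> \<omega> \<inter> ?Q u)) \<partial>M)
        \<le> ennreal (exp (lam * s\<^sup>2 * (c u * exp (c u)) + (if u \<in> S then exp (\<theta> - lam * s\<^sup>2) else 0)))"
      unfolding Y_def inv using lam by (intro poisson_exp_moment K P c) simp
  qed
  also have "\<dots> = ennreal (exp (\<Sum>u\<in>F. lam * s\<^sup>2 * (c u * exp (c u)) + (if u \<in> S then exp (\<theta> - lam * s\<^sup>2) else 0)))"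
    by (simp add: exp_sum[OF F] prod_ennreal)
  finally show ?thesis .
qed

section \<open>Decay of the probability of bad squares\<close>

definition sup_dist :: "int \<times> int \<Rightarrow> nat" where
  "sup_dist w = nat (max \<bar>fst w\<bar> \<bar>snd w\<bar>)"

lemma sup_dist_le_iff: "sup_dist w \<le> k \<longleftrightarrow> w \<in> {- int k..int k} \<times> {- int k..int k}"
  by (cases w) (auto simp: sup_dist_def)

lemma finite_sup_dist_le: "finite {w. sup_dist w \<le> k}"
  by (simp add: sup_dist_le_iff)

lemma card_sup_dist_le: "card {w. sup_dist w \<le> k} = (2 * k + 1)\<^sup>2"
proof -
  have "{w. sup_dist w \<le> k} = {- int k..int k} \<times> {- int k..int k}"
    by (auto simp: sup_dist_le_iff)
  then show ?thesis by (simp add: power2_eq_square nat_add_distrib nat_mult_distrib)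
qed

text \<open>The four sides of a square contour, with corners counted twice; the bound then also
  covers \<open>k = 0\<close>.\<close>

lemma card_sup_dist_eq: "card {w. sup_dist w = k} \<le> 8 * k + 4"
proof -
  let ?k = "int k"
  have "{w. sup_dist w = k} \<subseteq> {- ?k, ?k} \<times> {- ?k..?k} \<union> {- ?k..?k} \<times> {- ?k, ?k}"
    by (auto simp: sup_dist_def max_def split: if_splits)
  then have "card {w. sup_dist w = k} \<le> card ({- ?k, ?k} \<times> {- ?k..?k} \<union> {- ?k..?k} \<times> {- ?k, ?k})"
    by (rule card_mono[rotated]) simp
  also have "\<dots> \<le> card ({- ?k, ?k} \<times> {- ?k..?k}) + card ({- ?k..?k} \<times> {- ?k, ?k})"
    by (rule card_Un_le)
  also have "\<dots> \<le> 2 * (2 * k + 1) + (2 * k + 1) * 2"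
  proof -
    have "card {- ?k, ?k} \<le> 2" by (simp add: card_insert_if)
    moreover have "card {- ?k..?k} = 2 * k + 1" by simp
    ultimately show ?thesis unfolding card_cartesian_product
      by (intro add_mono mult_mono) simp_all
  qed
  finally show ?thesis by simp
qed

text \<open>
  Points of two squares at \<open>sup_dist\<close> equal to \<open>k + 1\<close> have distance at least \<open>s * k\<close>; the truncated
  subtraction covers the case of equal squares.
\<close>

definition site_kernel :: "(real \<Rightarrow> real) \<Rightarrow> real \<Rightarrow> int \<times> int \<Rightarrow> real" where
  "site_kernel l s w = l (s * real (sup_dist w - 1))"

context
  fixes l :: "real \<Rightarrow> real"
  assumes l_range: "\<And>r. r \<ge> 0 \<Longrightarrow> 0 \<le> l r \<and> l r \<le> 1"
    and l_decreasing: "strict_antimono_on {0..} l"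
begin

lemma attenuation_antimono: "0 \<le> r \<Longrightarrow> r \<le> t \<Longrightarrow> l t \<le> l r"
  using l_decreasing by (cases "r = t") (auto simp: monotone_on_def less_imp_le)

lemma attenuation_pos: "0 \<le> r \<Longrightarrow> l r > 0"
  using monotone_onD[OF l_decreasing, of r "r + 1"] l_range[of "r + 1"] by simp

text \<open>Extended by the constant \<open>l 0\<close> to the negative reals, the attenuation is
  monotone, hence Borel.\<close>

lemma attenuation_borel: "(\<lambda>r. l \<bar>r\<bar>) \<in> borel_measurable borel"
proof -
  have "mono (\<lambda>r. - l (max 0 r))"
    by (intro monoI) (auto intro!: attenuation_antimono)
  then have "(\<lambda>r. - l (max 0 r)) \<in> borel_measurable borel" by (rule borel_measurable_mono)
  then have "(\<lambda>r. - (- l (max 0 \<bar>r\<bar>))) \<in> borel_measurable borel" by measurable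
  then show ?thesis by simp
qed

text \<open>An integral test. Although \<open>r * l r\<close> need not be monotone, on the interval
  from \<open>s * j\<close> to \<open>s * (j + 1)\<close> its factors are bounded below by
  \<open>s * j\<close> and \<open>l (s * (j + 1))\<close>, taken from opposite ends.\<close>

lemma summable_attenuation:
  assumes l_integrable: "(\<integral>\<^sup>+ r\<in>{0..}. ennreal (r * l r) \<partial>lborel) < \<infinity>" and s: "s > 0"
  shows "summable (\<lambda>j. real j * l (s * real (Suc j)))"
proof -
  let ?I = "\<lambda>j. {s * real j..<s * real (Suc j)}"
  let ?f = "\<lambda>j r. ennreal (s * real j * l (s * real (Suc j))) * indicator (?I j) r"
  have nonneg: "l (s * real j) \<ge> 0" for j using l_range[of "s * real j"] s by simp
  have sI: "(\<Sum>j. ?f j r) \<le> ennreal (r * l r) * indicator {0..} r" for r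
  proof (cases "r \<ge> 0")
    case True
    \<comment> \<open>The intervals are disjoint, so at \<open>r\<close> the series has at most the
      term with index \<open>k\<close>.\<close>
    define k where "k = nat \<lfloor>r / s\<rfloor>"
    have k: "r \<in> ?I j \<longleftrightarrow> j = k" for j
    proof -
      have "j = k \<longleftrightarrow> int j = \<lfloor>r / s\<rfloor>" using True s by (auto simp: k_def)
      also have "\<dots> \<longleftrightarrow> \<lfloor>r / s\<rfloor> = int j" by auto
      also have "\<dots> \<longleftrightarrow> r \<in> ?I j"
        using s by (simp add: floor_eq_iff field_simps)
      finally show ?thesis by blast
    qed
    have "(\<Sum>j. ?f j r) = ?f k r"
      using k by (subst suminf_finite[of "{k}"]) auto
    also have "\<dots> \<le> ennreal (r * l r)"
    proof -
      have "r \<in> ?I k" using k[of k] by blast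
      then have "s * real k * l (s * real (Suc k)) \<le> r * l r"
        using True s nonneg[of "Suc k"] by (intro mult_mono attenuation_antimono) auto
      then show ?thesis using \<open>r \<in> ?I k\<close> by (simp add: ennreal_leI)
    qed
    finally show ?thesis using True by simp
  next
    case False
    then have "r \<notin> ?I j" for j
      using s by (auto simp: not_le) (meson mult_nonneg_nonneg less_imp_le of_nat_0_le_iff order_trans not_le)
    then show ?thesis using False by simp
  qed
  have "(\<Sum>j. ennreal (s * s * (real j * l (s * real (Suc j))))) = (\<Sum>j. \<integral>\<^sup>+r. ?f j r \<partial>lborel)"
  proof (rule arg_cong[where f = suminf], rule ext)
    fix j
    have "(\<integral>\<^sup>+r. ?f j r \<partial>lborel) = ennreal (s * real j * l (s * real (Suc j))) * ennreal s"
      using s by (subst nn_integral_cmult_indicator) (auto simp: algebra_simps)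
    also have "\<dots> = ennreal (s * s * (real j * l (s * real (Suc j))))"
      using s nonneg[of "Suc j"] by (subst ennreal_mult'[symmetric]) (auto simp: mult_ac)
    finally show "ennreal (s * s * (real j * l (s * real (Suc j)))) = (\<integral>\<^sup>+r. ?f j r \<partial>lborel)" ..
  qed
  also have "\<dots> = (\<integral>\<^sup>+r. (\<Sum>j. ?f j r) \<partial>lborel)"
    by (rule nn_integral_suminf[symmetric]) measurable
  also have "\<dots> \<le> (\<integral>\<^sup>+ r\<in>{0..}. ennreal (r * l r) \<partial>lborel)"
    by (rule nn_integral_mono) (rule sI)
  finally have "(\<Sum>j. ennreal (s * s * (real j * l (s * real (Suc j))))) \<noteq> top"
    using l_integrable by (auto simp: top_unique)
  then have "summable (\<lambda>j. s * s * (real j * l (s * real (Suc j))))"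
  proof (rule summable_suminf_not_top[rotated])
    show "0 \<le> s * s * (real j * l (s * real (Suc j)))" for j
      using s nonneg[of "Suc j"] by (intro mult_nonneg_nonneg) auto
  qed
  then show ?thesis using s by (simp add: summable_cmult_iff)
qed

text \<open>The kernel is constant on each shell \<open>sup_dist w = k\<close>, and shells grow
  linearly, so the planar sum reduces to the series in \<open>summable_attenuation\<close>.\<close>

lemma site_kernel_sums_bounded:
  assumes l_integrable: "(\<integral>\<^sup>+ r\<in>{0..}. ennreal (r * l r) \<partial>lborel) < \<infinity>" and s: "s > 0"
  obtains A where "A > 0" "\<And>F. finite F \<Longrightarrow> sum (site_kernel l s) F \<le> A"
proof -
  define b where "b k = real (8 * k + 4) * l (s * real (k - 1))" for k :: nat
  have nonneg: "l (s * real j) \<ge> 0" for j using l_range[of "s * real j"] s by simp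
  have b0: "b k \<ge> 0" for k using nonneg by (simp add: b_def)
  \<comment> \<open>The shift by 2 produces the argument \<open>s * Suc j\<close>, and
    \<open>8 * (j + 2) + 4 = 8 * j + 20\<close> is at most \<open>28 * j\<close> for
    \<open>j \<ge> 1\<close>.\<close>
  have "summable (\<lambda>j. b (j + 2))"
  proof (rule summable_comparison_test'[of "\<lambda>j. 28 * (real j * l (s * real (Suc j)))" 1])
    show "summable (\<lambda>j. 28 * (real j * l (s * real (Suc j))))"
      by (intro summable_mult summable_attenuation l_integrable s)
    fix j :: nat assume "1 \<le> j"
    then have "real (8 * (j + 2) + 4) * l (s * real (Suc j)) \<le> (28 * real j) * l (s * real (Suc j))"
      by (intro mult_right_mono nonneg) simp
    then show "norm (b (j + 2)) \<le> 28 * (real j * l (s * real (Suc j)))"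
      using b0[of "j + 2"] by (simp add: b_def mult.assoc)
  qed
  then have sb: "summable b" by (simp only: summable_iff_shift)
  have "sum (site_kernel l s) F \<le> suminf b + 1" if F: "finite F" for F
  proof -
    obtain n where n: "sup_dist ` F \<subseteq> {..n}" using F finite_nat_iff_bounded_le by blast
    have "sum (site_kernel l s) F = (\<Sum>k\<le>n. \<Sum>w\<in>{w \<in> F. sup_dist w = k}. site_kernel l s w)"
      using F n by (intro sum.group[symmetric]) auto
    also have "\<dots> \<le> (\<Sum>k\<le>n. b k)"
    proof (rule sum_mono)
      fix k
      have "(\<Sum>w\<in>{w \<in> F. sup_dist w = k}. site_kernel l s w) = real (card {w \<in> F. sup_dist w = k}) * l (s * real (k - 1))"
        by (simp add: site_kernel_def)
      also have "\<dots> \<le> b k"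
        unfolding b_def
      proof (intro mult_right_mono nonneg)
        have "card {w \<in> F. sup_dist w = k} \<le> card {w. sup_dist w = k}"
          by (rule card_mono) (auto intro: finite_subset[OF _ finite_sup_dist_le[of k]])
        then show "real (card {w \<in> F. sup_dist w = k}) \<le> real (8 * k + 4)"
          using card_sup_dist_eq[of k] by (simp only: of_nat_le_iff)
      qed
      finally show "(\<Sum>w\<in>{w \<in> F. sup_dist w = k}. site_kernel l s w) \<le> b k" .
    qed
    also have "\<dots> \<le> suminf b" using sb b0 by (intro sum_le_suminf) auto
    finally show ?thesis by simp
  qed
  moreover have "suminf b + 1 > 0" using suminf_nonneg[OF sb b0] by simp
  ultimately show thesis using that by blast
qed

end

section \<open>Exponential moments of convolved counts\<close>

lemma convolution_le:
  fixes k :: "int \<times> int \<Rightarrow> real"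
  assumes A: "\<And>F. finite F \<Longrightarrow> sum k F \<le> A" and S: "finite S"
  shows "(\<Sum>z\<in>S. k (u - z)) \<le> A"
proof -
  have "(\<Sum>z\<in>S. k (u - z)) = sum k ((\<lambda>z. u - z) ` S)"
    by (subst sum.reindex) (auto simp: inj_on_def)
  then show ?thesis using A S by simp
qed

text \<open>Each site of \<open>S\<close> distributes a total mass of at most \<open>A\<close>.
  Together with the bound \<open>A\<close> on every single coefficient, this makes the exponent
  linear in \<open>card S\<close>.\<close>

lemma sum_convolution_le:
  fixes k :: "int \<times> int \<Rightarrow> real"
  assumes A: "\<And>F. finite F \<Longrightarrow> sum k F \<le> A" and F: "finite F"
  shows "(\<Sum>u\<in>F. \<Sum>z\<in>S. k (u - z)) \<le> A * card S"
proof -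
  have "(\<Sum>u\<in>F. k (u - z)) \<le> A" for z
  proof -
    have "(\<Sum>u\<in>F. k (u - z)) = sum k ((\<lambda>u. u - z) ` F)"
      by (subst sum.reindex) (auto simp: inj_on_def)
    then show ?thesis using A F by simp
  qed
  then have "(\<Sum>z\<in>S. \<Sum>u\<in>F. k (u - z)) \<le> (\<Sum>z\<in>S. A)" by (intro sum_mono)
  then show ?thesis by (subst sum.swap) (simp add: mult.commute)
qed

text \<open>In \<open>x * exp x\<close>, where \<open>x\<close> is the coefficient of a square, the
  exponential is bounded uniformly by \<open>convolution_le\<close>, and the linear factor is then
  summed by \<open>sum_convolution_le\<close>. The bound is uniform in \<open>F\<close>.\<close>

lemma poisson_convolution_exp_moment:
  fixes \<Phi> :: "'w \<Rightarrow> (real ^ 2) set" and k :: "int \<times> int \<Rightarrow> real" and \<theta> t A :: real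
  assumes ppp: "poisson_point_process M lam \<Phi>" and lam: "lam \<ge> 0" and s: "s > 0"
    and F: "finite F" and S: "finite S" and S': "finite S'" and t: "t \<ge> 0"
    and k: "\<And>w. k w \<ge> 0" and A: "\<And>F. finite F \<Longrightarrow> sum k F \<le> A"
  shows "(\<integral>\<^sup>+\<omega>. ennreal (exp (\<Sum>u\<in>F. t * (\<Sum>z\<in>S. k (u - z)) * card (\<Phi> \<omega> \<inter> square s u)
        + (if u \<in> S' \<and> card (\<Phi> \<omega> \<inter> square s u) = 0 then \<theta> else 0))) \<partial>M)
     \<le> ennreal (exp (lam * s\<^sup>2 * (t * A * exp (t * A)) * card S + card S' * exp (\<theta> - lam * s\<^sup>2)))"
proof -
  let ?b = "\<lambda>u. \<Sum>z\<in>S. k (u - z)" and ?\<mu> = "lam * s\<^sup>2"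
  have b0: "?b u \<ge> 0" for u using k by (simp add: sum_nonneg)
  have bA: "?b u \<le> A" for u by (rule convolution_le[OF A S])
  have \<mu>: "?\<mu> \<ge> 0" using lam by simp
  have "(\<integral>\<^sup>+\<omega>. ennreal (exp (\<Sum>u\<in>F. t * ?b u * card (\<Phi> \<omega> \<inter> square s u)
        + (if u \<in> S' \<and> card (\<Phi> \<omega> \<inter> square s u) = 0 then \<theta> else 0))) \<partial>M)
     \<le> ennreal (exp (\<Sum>u\<in>F. ?\<mu> * (t * ?b u * exp (t * ?b u)) + (if u \<in> S' then exp (\<theta> - ?\<mu>) else 0)))"
    using b0 t by (intro poisson_squares_exp_moment ppp lam s F) simp
  also have "(\<Sum>u\<in>F. ?\<mu> * (t * ?b u * exp (t * ?b u)) + (if u \<in> S' then exp (\<theta> - ?\<mu>) else 0))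
     \<le> ?\<mu> * (t * A * exp (t * A)) * card S + card S' * exp (\<theta> - ?\<mu>)"
  proof -
    have "(\<Sum>u\<in>F. ?\<mu> * (t * ?b u * exp (t * ?b u))) \<le> (\<Sum>u\<in>F. ?\<mu> * (t * ?b u * exp (t * A)))"
      using \<mu> t b0 bA by (intro sum_mono mult_left_mono) (auto intro: mult_left_mono)
    also have "\<dots> = ?\<mu> * t * exp (t * A) * (\<Sum>u\<in>F. ?b u)"
      by (simp add: sum_distrib_left mult_ac)
    also have "\<dots> \<le> ?\<mu> * t * exp (t * A) * (A * card S)"
      using \<mu> t by (intro mult_left_mono sum_convolution_le[OF A F]) auto
    finally have "(\<Sum>u\<in>F. ?\<mu> * (t * ?b u * exp (t * ?b u))) \<le> ?\<mu> * (t * A * exp (t * A)) * card S"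
      by (simp add: mult_ac)
    moreover have "(\<Sum>u\<in>F. if u \<in> S' then exp (\<theta> - ?\<mu>) else 0) \<le> card S' * exp (\<theta> - ?\<mu>)"
    proof -
      have "(\<Sum>u\<in>F. if u \<in> S' then exp (\<theta> - ?\<mu>) else 0) = real (card (F \<inter> S')) * exp (\<theta> - ?\<mu>)"
        using F by (simp flip: sum.inter_restrict)
      also have "\<dots> \<le> card S' * exp (\<theta> - ?\<mu>)"
        using S' by (intro mult_right_mono) (auto intro: card_mono)
      finally show ?thesis .
    qed
    ultimately show ?thesis by (simp add: sum.distrib)
  qed
  finally show ?thesis by (simp add: ennreal_leI)
qed

text \<open>The indicator of the 9 by 9 block, written as a kernel so that eavesdroppers and
  interference fall under the same moment bound.\<close>

definition block_kernel :: "int \<times> int \<Rightarrow> real" where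
  "block_kernel w = of_bool (sup_dist w \<le> 4)"

text \<open>The parameter \<open>n\<close> truncates the interference to a finite sum. A square is
  finally called bad if this holds for some \<open>n\<close>, that is, if some truncation exceeds
  \<open>T\<close> or one of the other two defects occurs.\<close>

definition bad_site ::
    "(real \<Rightarrow> real) \<Rightarrow> real \<Rightarrow> real \<Rightarrow> (real ^ 2) set \<Rightarrow> (real ^ 2) set \<Rightarrow> nat \<Rightarrow> int \<times> int \<Rightarrow> bool" where
  "bad_site l s T X E n z \<longleftrightarrow>
     card (X \<inter> square s z) = 0 \<or> (\<exists>w. sup_dist w \<le> 4 \<and> card (E \<inter> square s (z + w)) \<noteq> 0) \<or>
     T < (\<Sum>u\<in>{u. sup_dist u \<le> n}. site_kernel l s (u - z) * card (X \<inter> square s u))"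

lemma (in prob_space) indep_var_nn_integral_mult:
  fixes f g :: "'a \<Rightarrow> ennreal"
  assumes "indep_var borel f borel g"
  shows "(\<integral>\<^sup>+\<omega>. f \<omega> * g \<omega> \<partial>M) = (\<integral>\<^sup>+\<omega>. f \<omega> \<partial>M) * (\<integral>\<^sup>+\<omega>. g \<omega> \<partial>M)"
proof -
  have *: "case_bool borel borel = (\<lambda>_. borel)" by (auto simp: fun_eq_iff split: bool.split)
  have "(\<integral>\<^sup>+\<omega>. (\<Prod>i\<in>UNIV. case_bool f g i \<omega>) \<partial>M) = (\<Prod>i\<in>UNIV. \<integral>\<^sup>+\<omega>. case_bool f g i \<omega> \<partial>M)"
    using assms unfolding indep_var_def * by (intro indep_vars_nn_integral) auto
  then show ?thesis by (simp add: UNIV_bool mult.commute)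
qed

lemma bad_site_mono:
  assumes "bad_site l s T X E n z" "n \<le> n'" "\<And>w. site_kernel l s w \<ge> 0"
  shows "bad_site l s T X E n' z"
proof -
  have "(\<Sum>u\<in>{u. sup_dist u \<le> n}. site_kernel l s (u - z) * card (X \<inter> square s u))
      \<le> (\<Sum>u\<in>{u. sup_dist u \<le> n'}. site_kernel l s (u - z) * card (X \<inter> square s u))"
    using assms(2,3) by (intro sum_mono2 finite_sup_dist_le) auto
  with assms(1) show ?thesis unfolding bad_site_def by (meson less_le_trans)
qed

lemma sets_bad_site:
  fixes \<Phi> \<Phi>E :: "'w \<Rightarrow> (real ^ 2) set"
  assumes "\<Phi> \<in> measurable M config_space" "\<Phi>E \<in> measurable M config_space"
  shows "{\<omega> \<in> space M. bad_site l s T (\<Phi> \<omega>) (\<Phi>E \<omega>) n z} \<in> sets M"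
proof -
  have [measurable]: "(\<lambda>\<omega>. card (\<Phi> \<omega> \<inter> square s u)) \<in> measurable M (count_space UNIV)"
    "(\<lambda>\<omega>. card (\<Phi>E \<omega> \<inter> square s u)) \<in> measurable M (count_space UNIV)" for u
    using assms by (auto intro!: measurable_card_config simp: bounded_square)
  show ?thesis unfolding bad_site_def by measurable
qed

text \<open>Each kind of defect at \<open>z\<close> makes one of three nonnegative terms at least
  \<open>\<theta>\<close>. Summing over \<open>S\<close> and exchanging sums attaches the
  coefficients to the squares, which gives a linear combination of counts plus the penalties for
  empty squares.\<close>

lemma bad_site_exponent_ge:
  fixes S :: "(int \<times> int) set" and \<theta> :: real
  assumes bad: "\<And>z. z \<in> S \<Longrightarrow> bad_site l s T X E n z"
    and S: "finite S" and T: "T > 0" and k: "\<And>w. site_kernel l s w \<ge> 0" and \<theta>: "\<theta> \<ge> 0"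
  defines "F \<equiv> {u. sup_dist u \<le> n} \<union> S"
    and "G \<equiv> (\<Union>z\<in>S. (+) z ` {w. sup_dist w \<le> 4})"
  shows "\<theta> * card S \<le>
    (\<Sum>u\<in>F. \<theta> / T * (\<Sum>z\<in>S. site_kernel l s (u - z)) * card (X \<inter> square s u)
        + (if u \<in> S \<and> card (X \<inter> square s u) = 0 then \<theta> else 0)) +
    (\<Sum>u\<in>G. \<theta> * (\<Sum>z\<in>S. block_kernel (u - z)) * card (E \<inter> square s u))"
proof -
  let ?k = "site_kernel l s"
  let ?I = "\<lambda>z. \<Sum>u\<in>F. ?k (u - z) * card (X \<inter> square s u)"
  let ?J = "\<lambda>z. \<Sum>u\<in>G. block_kernel (u - z) * card (E \<inter> square s u)"
  let ?O = "\<lambda>z. (if card (X \<inter> square s z) = 0 then \<theta> else 0)"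
  have fin: "finite F" "finite G"
    using S finite_sup_dist_le by (auto simp: F_def G_def)
  have I0: "?I z \<ge> 0" for z by (intro sum_nonneg mult_nonneg_nonneg k) simp
  have J0: "?J z \<ge> 0" for z by (simp add: sum_nonneg block_kernel_def)
  have I: "\<theta> / T * ?I z \<ge> 0" and J: "\<theta> * ?J z \<ge> 0" and O: "?O z \<ge> 0" for z
    using I0[of z] J0[of z] T \<theta> by (auto intro!: mult_nonneg_nonneg)
  have "\<theta> \<le> \<theta> / T * ?I z + ?O z + \<theta> * ?J z" if z: "z \<in> S" for z
    using bad[OF z] unfolding bad_site_def
  proof (elim disjE exE conjE)
    assume "card (X \<inter> square s z) = 0"
    then have "?O z = \<theta>" by simp
    then show ?thesis using I[of z] J[of z] by linarith
  next
    fix w assume w: "sup_dist w \<le> 4" "card (E \<inter> square s (z + w)) \<noteq> 0"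
    have "1 \<le> block_kernel (z + w - z) * real (card (E \<inter> square s (z + w)))"
      using w by (simp add: block_kernel_def)
    also have "\<dots> \<le> ?J z"
      using z w fin by (intro member_le_sum) (auto simp: G_def block_kernel_def)
    finally have "\<theta> * 1 \<le> \<theta> * ?J z" using \<theta> by (rule mult_left_mono)
    then show ?thesis using I[of z] O[of z] by linarith
  next
    assume "T < (\<Sum>u\<in>{u. sup_dist u \<le> n}. ?k (u - z) * card (X \<inter> square s u))"
    also have "\<dots> \<le> ?I z"
      using fin k by (intro sum_mono2) (auto simp: F_def)
    finally have "\<theta> / T * T \<le> \<theta> / T * ?I z" using \<theta> T by (intro mult_left_mono) auto
    moreover have "\<theta> / T * T = \<theta>" using T by simp
    ultimately show ?thesis using J[of z] O[of z] by linarith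
  qed
  then have "(\<Sum>z\<in>S. \<theta>) \<le> (\<Sum>z\<in>S. \<theta> / T * ?I z + ?O z + \<theta> * ?J z)" by (rule sum_mono)
  also have "\<dots> = (\<Sum>z\<in>S. \<theta> / T * ?I z) + (\<Sum>z\<in>S. ?O z) + (\<Sum>z\<in>S. \<theta> * ?J z)"
    by (simp add: sum.distrib)
  also have "(\<Sum>z\<in>S. \<theta> / T * ?I z) = (\<Sum>u\<in>F. \<theta> / T * (\<Sum>z\<in>S. ?k (u - z)) * card (X \<inter> square s u))"
    unfolding sum_distrib_left sum_distrib_right mult.assoc by (rule sum.swap)
  also have "(\<Sum>z\<in>S. \<theta> * ?J z) = (\<Sum>u\<in>G. \<theta> * (\<Sum>z\<in>S. block_kernel (u - z)) * card (E \<inter> square s u))"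
    unfolding sum_distrib_left sum_distrib_right mult.assoc by (rule sum.swap)
  also have "(\<Sum>z\<in>S. ?O z) = (\<Sum>u\<in>F. if u \<in> S \<and> card (X \<inter> square s u) = 0 then \<theta> else 0)"
    by (intro sum.mono_neutral_cong_left fin) (auto simp: F_def)
  finally show ?thesis by (simp add: sum.distrib mult.commute)
qed

text \<open>
  With \<open>\<theta> = 11\<close> the exponential Markov inequality gives \<open>exp (- 11 * m)\<close> times a factor \<open>exp m\<close> for
  each of the three kinds of defects, and \<open>exp (- 2) \<le> 1 / 6\<close>. The constant 891 is \<open>11 * 9\<^sup>2\<close>.
\<close>

lemma bad_sites_decay:
  fixes \<Phi> \<Phi>E :: "'w \<Rightarrow> (real ^ 2) set"
  assumes ppp: "poisson_point_process M lam \<Phi>" and pppE: "poisson_point_process M lamE \<Phi>E"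
    and indep: "prob_space.indep_var M config_space \<Phi> config_space \<Phi>E"
    and s: "s > 0" and lam: "lam * s\<^sup>2 \<ge> 11" and lamE: "lamE \<ge> 0" "lamE * s\<^sup>2 * (891 * exp 891) \<le> 1"
    and k: "\<And>w. site_kernel l s w \<ge> 0"
    and A: "A > 0" "\<And>F. finite F \<Longrightarrow> sum (site_kernel l s) F \<le> A"
    and T: "T = 11 * A * (1 + 3 * (lam * s\<^sup>2))"
    and S: "finite S" "S \<noteq> {}"
  shows "measure M (\<Inter>z\<in>S. {\<omega> \<in> space M. \<exists>n. bad_site l s T (\<Phi> \<omega>) (\<Phi>E \<omega>) n z}) \<le> (1 / 6) ^ (4 * card S)"
proof -
  interpret prob_space M using ppp by (simp add: poisson_point_process_def)
  have \<Phi>: "\<Phi> \<in> measurable M config_space" and \<Phi>E: "\<Phi>E \<in> measurable M config_space"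
    using ppp pppE by (auto simp: poisson_point_process_def)
  have "lam * s\<^sup>2 > 0" using lam by simp
  then have lam0: "lam \<ge> 0" using s by (simp add: zero_less_mult_iff)
  have T0: "T > 0" using A(1) lam by (simp add: T)
  define m where "m = card S"
  define B where "B n = (\<Inter>z\<in>S. {\<omega> \<in> space M. bad_site l s T (\<Phi> \<omega>) (\<Phi>E \<omega>) n z})" for n
  have B: "B n \<in> events" for n
    unfolding B_def using S by (intro sets.finite_INT sets_bad_site \<Phi> \<Phi>E)
  have B_le: "prob (B n) \<le> (1 / 6) ^ (4 * m)" for n
  proof -
    define F where "F = {u. sup_dist u \<le> n} \<union> S"
    define G where "G = (\<Union>z\<in>S. (+) z ` {w. sup_dist w \<le> 4})"
    define f where "f X = ennreal (exp (\<Sum>u\<in>F. 11 / T * (\<Sum>z\<in>S. site_kernel l s (u - z)) * card (X \<inter> square s u)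
        + (if u \<in> S \<and> card (X \<inter> square s u) = 0 then 11 else 0)))" for X
    \<comment> \<open>The empty set of penalised squares gives \<open>g\<close> the shape of
      \<open>poisson_convolution_exp_moment\<close>.\<close>
    define g where "g E = ennreal (exp (\<Sum>u\<in>G. 11 * (\<Sum>z\<in>S. block_kernel (u - z)) * card (E \<inter> square s u)
        + (if u \<in> {} \<and> card (E \<inter> square s u) = 0 then 0 else 0)))" for E
    have finF: "finite F" and finG: "finite G"
      using S finite_sup_dist_le by (auto simp: F_def G_def)
    have [measurable]: "(\<lambda>X. card (X \<inter> square s u)) \<in> measurable config_space (count_space UNIV)" for u
      by (rule measurable_card_config) (auto simp: bounded_square)
    have "f \<in> borel_measurable config_space" "g \<in> borel_measurable config_space"
      unfolding f_def g_def by measurable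
    then have "indep_var borel (f \<circ> \<Phi>) borel (g \<circ> \<Phi>E)"
      by (intro indep_var_compose[OF indep])
    then have prod: "(\<integral>\<^sup>+\<omega>. f (\<Phi> \<omega>) * g (\<Phi>E \<omega>) \<partial>M) = (\<integral>\<^sup>+\<omega>. f (\<Phi> \<omega>) \<partial>M) * (\<integral>\<^sup>+\<omega>. g (\<Phi>E \<omega>) \<partial>M)"
      using indep_var_nn_integral_mult[of "f \<circ> \<Phi>" "g \<circ> \<Phi>E"] by (simp add: comp_def)
    have "(\<integral>\<^sup>+\<omega>. f (\<Phi> \<omega>) \<partial>M) \<le> ennreal (exp (lam * s\<^sup>2 * (11 / T * A * exp (11 / T * A)) * m + m * exp (11 - lam * s\<^sup>2)))"
      unfolding f_def m_def using S T0
      by (intro poisson_convolution_exp_moment ppp lam0 s finF k A) auto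
    also have "\<dots> \<le> ennreal (exp (2 * m))"
    proof (intro ennreal_leI, unfold exp_le_cancel_iff)
      define \<mu> where "\<mu> = lam * s\<^sup>2"
      have \<mu>: "\<mu> \<ge> 11" using lam by (simp add: \<mu>_def)
      \<comment> \<open>\<open>T\<close> is chosen for this identity: the tilt is at most 1, so its
        exponential is at most 3, and \<open>3 * \<mu> / (1 + 3 * \<mu>)\<close> is at most 1 for
        every intensity.\<close>
      have q: "11 / T * A = 1 / (1 + 3 * \<mu>)" using A(1) by (simp add: T \<mu>_def)
      have "exp (1 / (1 + 3 * \<mu>)) \<le> exp 1" using \<mu> by simp
      also have "\<dots> \<le> (3::real)" by (rule exp_le)
      finally have "\<mu> * (1 / (1 + 3 * \<mu>) * exp (1 / (1 + 3 * \<mu>))) \<le> \<mu> * (1 / (1 + 3 * \<mu>) * 3)"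
        using \<mu> by (intro mult_left_mono) auto
      also have "\<dots> \<le> 1" using \<mu> by (simp add: field_simps)
      finally have "\<mu> * (11 / T * A * exp (11 / T * A)) * m \<le> 1 * real m"
        unfolding q by (rule mult_right_mono) simp
      moreover have "m * exp (11 - \<mu>) \<le> real m * 1"
        using \<mu> by (intro mult_left_mono) auto
      ultimately show "lam * s\<^sup>2 * (11 / T * A * exp (11 / T * A)) * m + m * exp (11 - lam * s\<^sup>2) \<le> 2 * m"
        unfolding \<mu>_def by simp
    qed
    finally have Ef: "(\<integral>\<^sup>+\<omega>. f (\<Phi> \<omega>) \<partial>M) \<le> ennreal (exp (2 * m))" .
    have kE: "sum block_kernel H \<le> (81 :: real)" if "finite H" for H
    proof -
      have "card (H \<inter> {w. sup_dist w \<le> 4}) \<le> card {w. sup_dist w \<le> 4}"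
        by (intro card_mono finite_sup_dist_le) auto
      also have "\<dots> = 81" unfolding card_sup_dist_le by simp
      finally have "card (H \<inter> {w. sup_dist w \<le> 4}) \<le> 81" .
      then show ?thesis using that by (simp add: block_kernel_def of_bool_def sum.If_cases Int_def)
    qed
    have "(\<integral>\<^sup>+\<omega>. g (\<Phi>E \<omega>) \<partial>M) \<le> ennreal (exp (lamE * s\<^sup>2 * (11 * 81 * exp (11 * 81)) * card S + card ({} :: (int \<times> int) set) * exp (0 - lamE * s\<^sup>2)))"
      unfolding g_def using S T0
      by (intro poisson_convolution_exp_moment pppE lamE s finG kE) (auto simp: block_kernel_def)
    also have "\<dots> \<le> ennreal (exp m)"
      using mult_right_mono[OF lamE(2), of "real m"] by (intro ennreal_leI) (simp add: m_def)
    finally have Eg: "(\<integral>\<^sup>+\<omega>. g (\<Phi>E \<omega>) \<partial>M) \<le> ennreal (exp m)" .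
    have "emeasure M (B n) = (\<integral>\<^sup>+\<omega>. indicator (B n) \<omega> \<partial>M)" using B by simp
    \<comment> \<open>The exponential Markov inequality, in pointwise form: on \<open>B n\<close>
      the combined exponent of \<open>f\<close> and \<open>g\<close> is at least
      \<open>11 * m\<close>.\<close>
    also have "\<dots> \<le> (\<integral>\<^sup>+\<omega>. ennreal (exp (- 11 * m)) * (f (\<Phi> \<omega>) * g (\<Phi>E \<omega>)) \<partial>M)"
    proof (rule nn_integral_mono)
      fix \<omega>
      show "indicator (B n) \<omega> \<le> ennreal (exp (- 11 * m)) * (f (\<Phi> \<omega>) * g (\<Phi>E \<omega>))"
      proof (cases "\<omega> \<in> B n")
        case True
        then have "bad_site l s T (\<Phi> \<omega>) (\<Phi>E \<omega>) n z" if "z \<in> S" for z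
          using that by (auto simp: B_def)
        from bad_site_exponent_ge[OF this S(1) T0 k, of 11]
        have "exp (11 * m) \<le> exp (
          (\<Sum>u\<in>F. 11 / T * (\<Sum>z\<in>S. site_kernel l s (u - z)) * card (\<Phi> \<omega> \<inter> square s u)
              + (if u \<in> S \<and> card (\<Phi> \<omega> \<inter> square s u) = 0 then 11 else 0)) +
          (\<Sum>u\<in>G. 11 * (\<Sum>z\<in>S. block_kernel (u - z)) * card (\<Phi>E \<omega> \<inter> square s u)))"
          unfolding m_def F_def G_def exp_le_cancel_iff by simp
        then have "ennreal (exp (11 * m)) \<le> f (\<Phi> \<omega>) * g (\<Phi>E \<omega>)"
          unfolding f_def g_def exp_add by (subst ennreal_mult'[symmetric]) (auto intro: ennreal_leI)
        then have "ennreal (exp (- 11 * m)) * ennreal (exp (11 * m)) \<le> ennreal (exp (- 11 * m)) * (f (\<Phi> \<omega>) * g (\<Phi>E \<omega>))"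
          by (rule mult_left_mono) simp
        then show ?thesis using True by (simp add: ennreal_mult'[symmetric] exp_add[symmetric])
      qed simp
    qed
    also have "\<dots> = ennreal (exp (- 11 * m)) * (\<integral>\<^sup>+\<omega>. f (\<Phi> \<omega>) * g (\<Phi>E \<omega>) \<partial>M)"
      using \<open>f \<in> _\<close> \<open>g \<in> _\<close> \<Phi> \<Phi>E by (intro nn_integral_cmult borel_measurable_times_ennreal) (auto intro: measurable_compose)
    also have "\<dots> \<le> ennreal (exp (- 11 * m)) * (ennreal (exp (2 * m)) * ennreal (exp m))"
      unfolding prod by (intro mult_left_mono mult_mono Ef Eg) auto
    also have "\<dots> = ennreal (exp (- 11 * m) * (exp (2 * m) * exp m))"
      by (simp add: ennreal_mult')
    also have "exp (- 11 * m) * (exp (2 * m) * exp m) = exp (- 8 * real m)"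
      by (simp flip: exp_add)
    also have "\<dots> = (exp (- 2)) ^ (4 * m)" by (simp flip: exp_of_nat_mult)
    also have "\<dots> \<le> ennreal ((1 / 6) ^ (4 * m))"
    proof (intro ennreal_leI power_mono)
      \<comment> \<open>The Taylor bound \<open>1 + 1 + 1/2\<close> for \<open>exp 1\<close> is just
        good enough: its square 25/4 exceeds 6.\<close>
      have "(5 / 2) ^ 2 \<le> (exp 1 :: real) ^ 2"
        using exp_lower_Taylor_quadratic[of 1] by (intro power_mono) auto
      then have "6 \<le> exp (2 :: real)" by (simp add: power2_eq_square flip: exp_add)
      then show "exp (- 2) \<le> (1 / 6 :: real)" by (simp add: exp_minus field_simps)
    qed simp
    finally show ?thesis by (simp add: emeasure_eq_measure)
  qed
  have mono: "incseq B"
    unfolding B_def by (intro monoI) (blast intro: bad_site_mono k)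
  \<comment> \<open>As \<open>S\<close> is finite, the largest truncation serves all its sites. The
    bound for \<open>B n\<close> does not depend on \<open>n\<close> and passes to the increasing
    union.\<close>
  have "(\<Inter>z\<in>S. {\<omega> \<in> space M. \<exists>n. bad_site l s T (\<Phi> \<omega>) (\<Phi>E \<omega>) n z}) \<subseteq> (\<Union>n. B n)"
  proof
    fix \<omega> assume \<omega>: "\<omega> \<in> (\<Inter>z\<in>S. {\<omega> \<in> space M. \<exists>n. bad_site l s T (\<Phi> \<omega>) (\<Phi>E \<omega>) n z})"
    then obtain n where n: "\<And>z. z \<in> S \<Longrightarrow> bad_site l s T (\<Phi> \<omega>) (\<Phi>E \<omega>) (n z) z" by simp metis
    have "bad_site l s T (\<Phi> \<omega>) (\<Phi>E \<omega>) (Max (n ` S)) z" if "z \<in> S" for z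
      using n[OF that] by (rule bad_site_mono) (use that S k in auto)
    then have "\<omega> \<in> B (Max (n ` S))" using \<omega> S(2) by (simp add: B_def)
    then show "\<omega> \<in> (\<Union>n. B n)" by blast
  qed
  then have "prob (\<Inter>z\<in>S. {\<omega> \<in> space M. \<exists>n. bad_site l s T (\<Phi> \<omega>) (\<Phi>E \<omega>) n z}) \<le> prob (\<Union>n. B n)"
    using B by (intro finite_measure_mono) auto
  also have "\<dots> \<le> (1 / 6) ^ (4 * m)"
  proof (rule LIMSEQ_le_const2)
    show "(\<lambda>n. prob (B n)) \<longlonglongrightarrow> prob (\<Union>n. B n)"
      using B by (intro finite_Lim_measure_incseq mono) auto
  qed (use B_le in auto)
  finally show ?thesis by (simp add: m_def)
qed

section \<open>Edges between good squares\<close>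

text \<open>In the coordinate that attains \<open>sup_dist\<close>, intervals with indices
  \<open>a\<close> and \<open>b\<close> leave a gap of at least
  \<open>s * (\<bar>a - b\<bar> - 1)\<close>.\<close>

lemma sup_dist_diff_lower:
  assumes s: "s > 0" and x: "x \<in> square s u" and y: "y \<in> square s z"
  shows "s * real (sup_dist (u - z) - 1) \<le> dist x y"
proof -
  have 1: "\<bar>x $ i - y $ i\<bar> \<le> dist x y" for i
    using component_le_norm_cart[of "x - y" i] by (simp add: dist_norm)
  have coord: "s * (\<bar>of_int a - of_int b\<bar> - 1) \<le> \<bar>p - q\<bar>"
    if "s * of_int a \<le> p" "p < s * (of_int a + 1)" "s * of_int b \<le> q" "q < s * (of_int b + 1)"
    for a b :: int and p q :: real
    using that s by (auto simp: abs_if algebra_simps)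
  have c: "s * (\<bar>of_int (fst u - z')\<bar> - 1) \<le> dist x y" if "z' = fst z" for z'
    using order_trans[OF coord 1[of 1], of "fst u" "fst z"] x y that by (auto simp: square_def)
  have d: "s * (\<bar>of_int (snd u - z')\<bar> - 1) \<le> dist x y" if "z' = snd z" for z'
    using order_trans[OF coord 1[of 2], of "snd u" "snd z"] x y that by (auto simp: square_def)
  show ?thesis
  proof (cases "sup_dist (u - z)")
    case (Suc k)
    then have "int k + 1 = max \<bar>fst u - fst z\<bar> \<bar>snd u - snd z\<bar>"
      by (simp add: sup_dist_def)
    then consider "int k + 1 = \<bar>fst u - fst z\<bar>" | "int k + 1 = \<bar>snd u - snd z\<bar>" by linarith
    then have "s * real k \<le> dist x y"
    proof cases
      case 1
      then have "real k = \<bar>of_int (fst u - fst z)\<bar> - 1" by linarith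
      with c show ?thesis by simp
    next
      case 2
      then have "real k = \<bar>of_int (snd u - snd z)\<bar> - 1" by linarith
      with d show ?thesis by simp
    qed
    with Suc show ?thesis by simp
  qed simp
qed

text \<open>The coordinates differ by at most \<open>2 * s\<close> in direction \<open>d\<close> and
  by at most \<open>s\<close> in the other one, so the sum norm suffices.\<close>

lemma dist_adjacent_squares:
  assumes s: "s > 0" and x: "x \<in> square s z" and y: "y \<in> square s (z + d)" and d: "d \<in> dirs"
  shows "dist x y \<le> 3 * s"
proof -
  have "dist x y \<le> (\<Sum>i\<in>UNIV. \<bar>(x - y) $ i\<bar>)"
    unfolding dist_norm by (rule norm_le_l1_cart)
  also have "\<dots> = \<bar>x $ 1 - y $ 1\<bar> + \<bar>x $ 2 - y $ 2\<bar>"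
    by (simp add: UNIV_2)
  also have "\<dots> \<le> 3 * s"
    using s x y d by (auto simp: square_def dirs_def abs_if algebra_simps)
  finally show ?thesis .
qed

lemma inverse_antimono_ennreal: "a \<le> b \<Longrightarrow> inverse b \<le> inverse (a :: ennreal)"
  by (cases a; cases b; cases "a = 0")
     (auto simp: inverse_ennreal ennreal_leI le_imp_inverse_le top_unique dest: order_antisym)

lemma divide_mono_ennreal:
  fixes a b c d :: ennreal
  assumes "a \<le> c" "d \<le> b"
  shows "a / b \<le> c / d"
  unfolding divide_ennreal_def using assms by (intro mult_mono inverse_antimono_ennreal) auto

section \<open>From good squares to an infinite out-component\<close>

context
  fixes l :: "real \<Rightarrow> real" and s T :: real and X E :: "(real ^ 2) set"
  assumes l_range: "\<And>r. r \<ge> 0 \<Longrightarrow> 0 \<le> l r \<and> l r \<le> 1"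
    and l_decreasing: "strict_antimono_on {0..} l"
    and s: "s > 0" and X: "locally_finite_set X" and E: "locally_finite_set E"
begin

private abbreviation "good z \<equiv> \<nexists>n. bad_site l s T X E n z"

lemma attenuation_le_site_kernel:
  assumes "x \<in> square s u" "y \<in> square s z"
  shows "l (dist x y) \<le> site_kernel l s (u - z)"
  unfolding site_kernel_def using s
  by (intro attenuation_antimono[OF l_range l_decreasing] sup_dist_diff_lower assms) auto

text \<open>Any finite set of nodes, grouped by squares, is dominated by a truncated kernel sum,
  which is at most \<open>T\<close> in a good square. The additional 1 pays for the node added at
  the origin.\<close>

lemma interference_le:
  assumes good: "good z" and y: "y \<in> square s z"
  shows "(\<Sum>\<^sub>\<infinity>x\<in>insert 0 X - A. ennreal (l (dist x y))) \<le> ennreal (T + 1)"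
proof -
  have nonneg: "l (dist x y) \<ge> 0" for x using l_range[of "dist x y"] by simp
  have sum_le: "(\<Sum>x\<in>F. ennreal (l (dist x y))) \<le> ennreal (T + 1)" if F: "finite F" "F \<subseteq> insert 0 X - A" for F
  proof -
    define H where "H = F - {0}"
    have H: "finite H" "H \<subseteq> X" using F by (auto simp: H_def)
    obtain n where n: "sup_dist ` square_index s ` H \<subseteq> {..n}"
      using H(1) finite_nat_iff_bounded_le by blast
    have "(\<Sum>x\<in>F. l (dist x y)) \<le> (\<Sum>x\<in>insert 0 H. l (dist x y))"
      using F nonneg by (intro sum_mono2) (auto simp: H_def)
    also have "\<dots> = l (dist 0 y) + (\<Sum>x\<in>H. l (dist x y))"
      using H by (subst sum.insert) (auto simp: H_def)
    also have "(\<Sum>x\<in>H. l (dist x y)) = (\<Sum>u\<in>{u. sup_dist u \<le> n}. \<Sum>x\<in>{x \<in> H. square_index s x = u}. l (dist x y))"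
      using n H by (intro sum.group[symmetric] finite_sup_dist_le) auto
    also have "\<dots> \<le> (\<Sum>u\<in>{u. sup_dist u \<le> n}. site_kernel l s (u - z) * card (X \<inter> square s u))"
    proof (rule sum_mono)
      fix u
      have k0: "site_kernel l s (u - z) \<ge> 0"
        unfolding site_kernel_def using l_range s by simp
      have "(\<Sum>x\<in>{x \<in> H. square_index s x = u}. l (dist x y))
          \<le> (\<Sum>x\<in>{x \<in> H. square_index s x = u}. site_kernel l s (u - z))"
        by (intro sum_mono attenuation_le_site_kernel y) (use s in \<open>simp add: mem_square_iff\<close>)
      also have "\<dots> = site_kernel l s (u - z) * card {x \<in> H. square_index s x = u}" by simp
      also have "\<dots> \<le> site_kernel l s (u - z) * card (X \<inter> square s u)"
      proof (intro mult_left_mono k0, unfold of_nat_le_iff, rule card_mono)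
        show "finite (X \<inter> square s u)"
          using X bounded_square by (simp add: locally_finite_set_def)
      qed (use H s in \<open>auto simp: mem_square_iff\<close>)
      finally show "(\<Sum>x\<in>{x \<in> H. square_index s x = u}. l (dist x y))
          \<le> site_kernel l s (u - z) * card (X \<inter> square s u)" .
    qed
    also have "\<dots> \<le> T" using good by (auto simp: bad_site_def not_less)
    finally have "(\<Sum>x\<in>F. l (dist x y)) \<le> T + 1"
      using l_range[of "dist 0 y"] by simp
    then show ?thesis using nonneg by (simp add: sum_ennreal ennreal_leI)
  qed
  have "(\<Sum>\<^sub>\<infinity>x\<in>insert 0 X - A. ennreal (l (dist x y)))
      = (SUP F\<in>{F. finite F \<and> F \<subseteq> insert 0 X - A}. \<Sum>x\<in>F. ennreal (l (dist x y)))"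
    by (rule nonneg_infsum_complete) simp
  also have "\<dots> \<le> ennreal (T + 1)" by (rule SUP_least) (use sum_le in blast)
  finally show ?thesis .
qed

text \<open>The square of \<open>e\<close> lies outside the block, hence at \<open>sup_dist\<close>
  at least 5, and \<open>sup_dist_diff_lower\<close> loses one side length.\<close>

lemma eavesdropper_far:
  assumes good: "good z" and x: "x \<in> square s z" and e: "e \<in> E"
  shows "4 * s \<le> dist x e"
proof -
  let ?u = "square_index s e"
  have eu: "e \<in> square s ?u" using s by (simp add: mem_square_iff)
  have "\<not> sup_dist (?u - z) \<le> 4"
  proof
    assume "sup_dist (?u - z) \<le> 4"
    with good have "card (E \<inter> square s (z + (?u - z))) = 0" unfolding bad_site_def by blast
    moreover have "z + (?u - z) = ?u" by simp
    ultimately have "card (E \<inter> square s ?u) = 0" by (simp only:)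
    moreover have "finite (E \<inter> square s ?u)"
      using E bounded_square by (simp add: locally_finite_set_def)
    ultimately show False using e eu by auto
  qed
  then have "s * 4 \<le> s * real (sup_dist (?u - z) - 1)" using s by (intro mult_left_mono) auto
  also have "\<dots> \<le> dist e x" by (rule sup_dist_diff_lower[OF s eu x])
  finally show ?thesis by (simp add: dist_commute)
qed

text \<open>Dropping all interference bounds the ratio at an eavesdropper by
  \<open>l (4 * s)\<close>, while the ratio at \<open>y\<close> is at least
  \<open>l (3 * s) / (1 + \<gamma> * (T + 1))\<close>. The condition on \<open>\<gamma>\<close>
  separates these values.\<close>

lemma good_sites_edge:
  assumes good: "good z" "good (z + d)" and d: "d \<in> dirs"
    and x: "x \<in> insert 0 X" "x \<in> square s z" and y: "y \<in> insert 0 X" "y \<in> square s (z + d)"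
    and \<gamma>: "\<gamma> \<ge> 0" "l (4 * s) * (1 + \<gamma> * (T + 1)) < l (3 * s)" and T: "T \<ge> 0"
  shows "(x, y) \<in> ssg_edges l \<gamma> (insert 0 X) E"
proof -
  have "x \<noteq> y" using x y d s by (auto simp: mem_square_iff dirs_def zero_prod_def)
  moreover have "sinr_eavesdropper l (insert 0 X) x e < sinr_node l \<gamma> (insert 0 X) x y" if e: "e \<in> E" for e
  proof -
    have pos: "1 + \<gamma> * (T + 1) > 0" using \<gamma> T by (simp add: add_pos_nonneg)
    have "sinr_eavesdropper l (insert 0 X) x e \<le> ennreal (l (dist x e))"
      unfolding sinr_eavesdropper_def
      by (rule order_trans[OF divide_mono_ennreal[OF order_refl, of 1]]) (auto simp: divide_ennreal_def)
    also have "\<dots> \<le> ennreal (l (4 * s))"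
      using s by (intro ennreal_leI attenuation_antimono[OF l_range l_decreasing] eavesdropper_far[OF good(1) x(2) e]) auto
    also have "\<dots> < ennreal (l (3 * s) / (1 + \<gamma> * (T + 1)))"
      using pos \<gamma>(2) attenuation_pos[OF l_range l_decreasing, of "3 * s"] s
      by (intro ennreal_lessI divide_pos_pos) (auto simp: less_divide_eq)
    also have "\<dots> = ennreal (l (3 * s)) / ennreal (1 + \<gamma> * (T + 1))"
      using pos l_range[of "3 * s"] s by (simp add: divide_ennreal)
    also have "\<dots> \<le> sinr_node l \<gamma> (insert 0 X) x y"
      unfolding sinr_node_def
    proof (rule divide_mono_ennreal)
      have "ennreal \<gamma> * (\<Sum>\<^sub>\<infinity>z\<in>insert 0 X - {x, y}. ennreal (l (dist z y))) \<le> ennreal \<gamma> * ennreal (T + 1)"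
        by (intro mult_left_mono interference_le[OF good(2) y(2)]) simp
      then show "1 + ennreal \<gamma> * (\<Sum>\<^sub>\<infinity>z\<in>insert 0 X - {x, y}. ennreal (l (dist z y))) \<le> ennreal (1 + \<gamma> * (T + 1))"
        using \<gamma> T by (simp add: ennreal_plus ennreal_mult ennreal_1[symmetric] del: ennreal_1)
      show "ennreal (l (3 * s)) \<le> ennreal (l (dist x y))"
        using dist_adjacent_squares[OF s x(2) y(2) d]
        by (intro ennreal_leI attenuation_antimono[OF l_range l_decreasing]) auto
    qed
    finally show ?thesis .
  qed
  ultimately show ?thesis using x y by (auto simp: ssg_edges_def)
qed

text \<open>The good squares reachable from the origin cannot form a finite set, by
  \<open>grow\<close>. Starting from the node at the origin, an edge into each newly reached square
  puts a node of it into the out-component, and distinct squares are disjoint.\<close>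

lemma infinite_out_component:
  assumes good0: "good (0, 0)"
    and grow: "\<And>C. finite C \<Longrightarrow> (0, 0) \<in> C \<Longrightarrow> \<exists>u\<in>C. \<exists>d\<in>dirs. u + d \<notin> C \<and> good (u + d)"
    and \<gamma>: "\<gamma> \<ge> 0" "l (4 * s) * (1 + \<gamma> * (T + 1)) < l (3 * s)" and T: "T \<ge> 0"
  shows "infinite (out_component l \<gamma> (insert 0 X) E 0)"
proof -
  define step where "step = {(u, u + d) | u d. d \<in> dirs \<and> good (u + d)}"
  define C where "C = {z. ((0, 0), z) \<in> step\<^sup>*}"
  let ?O = "out_component l \<gamma> (insert 0 X) E 0"
  have "infinite C"
  proof
    assume "finite C"
    moreover have "(0, 0) \<in> C" by (simp add: C_def)
    ultimately obtain u d where u: "u \<in> C" "d \<in> dirs" "u + d \<notin> C" "good (u + d)"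
      using grow by blast
    then have "(u, u + d) \<in> step" unfolding step_def by blast
    with u(1) have "u + d \<in> C" by (auto simp: C_def)
    with u(3) show False by simp
  qed
  have zero: "0 \<in> square s (0, 0)" using s by (simp add: mem_square_iff square_index_def)
  have "good z \<and> (\<exists>y\<in>?O. y \<in> square s z)" if "((0, 0), z) \<in> step\<^sup>*" for z
    using that
  proof (induction rule: rtrancl_induct)
    case base
    then show ?case using good0 zero by (auto simp: out_component_def)
  next
    case (step u z)
    then obtain x where x: "x \<in> ?O" "x \<in> square s u" by blast
    obtain d where d: "z = u + d" "d \<in> dirs" "good (u + d)" using step.hyps(2) by (auto simp: step_def)
    from d(3) have "card (X \<inter> square s (u + d)) \<noteq> 0" by (auto simp: bad_site_def)
    then obtain y where y: "y \<in> X" "y \<in> square s (u + d)" by (metis IntE card.empty ex_in_conv)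
    have "(x, y) \<in> ssg_edges l \<gamma> (insert 0 X) E"
      using good_sites_edge[OF _ d(3) d(2) _ x(2) _ y(2) \<gamma> T] step.IH x y by (simp add: out_component_def)
    then have "y \<in> ?O" using x y by (auto simp: out_component_def)
    then show ?case using d y by auto
  qed
  then have "C \<subseteq> square_index s ` ?O"
    using s by (force simp: C_def mem_square_iff)
  with \<open>infinite C\<close> show ?thesis by (metis finite_imageI finite_subset)
qed

end

section \<open>Choice of the parameters and conclusion\<close>

theorem theorem1p1:
  fixes l :: "real \<Rightarrow> real" and lamE :: real
  assumes l_range: "\<And>r. r \<ge> 0 \<Longrightarrow> 0 \<le> l r \<and> l r \<le> 1"
    and l_decreasing: "strict_antimono_on {0..} l"
    and l_integrable: "(\<integral>\<^sup>+ r\<in>{0..}. ennreal (r * l r) \<partial>lborel) < \<infinity>"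
    and lamE_pos: "lamE > 0"
  shows "\<exists>(lam' :: real) (\<gamma>' :: real \<Rightarrow> real).
    (\<forall>lam > 0. \<gamma>' lam > 0) \<and>
    (\<forall>lam > 0. \<forall>\<gamma>. lam > lam' \<longrightarrow> 0 < \<gamma> \<longrightarrow> \<gamma> \<le> 1 \<longrightarrow> \<gamma> < \<gamma>' lam \<longrightarrow>
      (\<forall>(M :: 'w measure) (\<Phi> :: 'w \<Rightarrow> (real ^ 2) set) (\<Phi>E :: 'w \<Rightarrow> (real ^ 2) set).
        poisson_point_process M lam \<Phi> \<longrightarrow>
        poisson_point_process M lamE \<Phi>E \<longrightarrow>
        prob_space.indep_var M config_space \<Phi> config_space \<Phi>E \<longrightarrow>
        measure M {\<omega> \<in> space M.
          infinite (out_component l \<gamma> (insert 0 (\<Phi> \<omega>)) (\<Phi>E \<omega>) 0)} > 0))"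
proof -
  \<comment> \<open>The side length makes the eavesdropper condition of
    \<open>bad_sites_decay\<close> an equality. It depends on \<open>lamE\<close> alone, so the
    threshold for \<open>lam\<close> can be fixed afterwards.\<close>
  define s where "s = sqrt (1 / (lamE * (891 * exp 891)))"
  have s: "s > 0" and s2: "lamE * s\<^sup>2 * (891 * exp 891) \<le> 1"
    using lamE_pos by (simp_all add: s_def)
  obtain A where A: "A > 0" "\<And>F. finite F \<Longrightarrow> sum (site_kernel l s) F \<le> A"
    using site_kernel_sums_bounded[OF l_range l_decreasing l_integrable s] by blast
  have k: "site_kernel l s w \<ge> 0" for w
    unfolding site_kernel_def using l_range s by simp
  define T where "T lam = 11 * A * (1 + 3 * (lam * s\<^sup>2))" for lam
  have T: "T lam > 0" if "lam > 0" for lam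
    using that A(1) by (simp add: T_def add_pos_nonneg)
  have l4: "l (4 * s) > 0" using s by (intro attenuation_pos[OF l_range l_decreasing]) auto
  have l34: "l (4 * s) < l (3 * s)" using monotone_onD[OF l_decreasing, of "3 * s" "4 * s"] s by simp
  \<comment> \<open>The value of \<open>\<gamma>\<close> at which
    \<open>l (4 * s) * (1 + \<gamma> * (T lam + 1))\<close> equals \<open>l (3 * s)\<close>.\<close>
  define \<gamma>' where "\<gamma>' lam = (l (3 * s) / l (4 * s) - 1) / (T lam + 1)" for lam
  show ?thesis
  \<comment> \<open>Above the intensity \<open>11 / s\<^sup>2\<close> a square contains at least 11
    legitimate nodes on average, as \<open>bad_sites_decay\<close> requires.\<close>
  proof (intro exI[of _ "11 / s\<^sup>2"] exI[of _ \<gamma>'] conjI allI impI)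
    show "\<gamma>' lam > 0" if "lam > 0" for lam
      unfolding \<gamma>'_def using T[OF that] l4 l34 by (intro divide_pos_pos) (auto simp: less_divide_eq)
  next
    fix lam \<gamma> :: real and M :: "'w measure" and \<Phi> \<Phi>E :: "'w \<Rightarrow> (real ^ 2) set"
    assume lam: "lam > 0" "11 / s\<^sup>2 < lam" and \<gamma>: "0 < \<gamma>" "\<gamma> < \<gamma>' lam"
      and ppp: "poisson_point_process M lam \<Phi>" and pppE: "poisson_point_process M lamE \<Phi>E"
      and indep: "prob_space.indep_var M config_space \<Phi> config_space \<Phi>E"
    interpret prob_space M using ppp by (simp add: poisson_point_process_def)
    have \<Phi>: "\<Phi> \<in> measurable M config_space" and \<Phi>E: "\<Phi>E \<in> measurable M config_space"
      using ppp pppE by (auto simp: poisson_point_process_def)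
    have lam_s: "lam * s\<^sup>2 \<ge> 11" using lam(2) s by (simp add: field_simps)
    have "\<gamma> * (T lam + 1) < l (3 * s) / l (4 * s) - 1"
      using \<gamma>(2) T[OF lam(1)] by (simp add: \<gamma>'_def less_divide_eq)
    then have \<gamma>l: "l (4 * s) * (1 + \<gamma> * (T lam + 1)) < l (3 * s)"
      using l4 by (simp add: field_simps)
    define bad where "bad z = {\<omega> \<in> space M. \<exists>n. bad_site l s (T lam) (\<Phi> \<omega>) (\<Phi>E \<omega>) n z}" for z
    have bad: "bad z \<in> events" for z
    proof -
      have "bad z = (\<Union>n. {\<omega> \<in> space M. bad_site l s (T lam) (\<Phi> \<omega>) (\<Phi>E \<omega>) n z})"
        by (auto simp: bad_def)
      then show ?thesis using sets_bad_site[OF \<Phi> \<Phi>E] by auto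
    qed
    have "prob (\<Inter>z\<in>S. bad z) \<le> (1 / 6) ^ (4 * card S)" if "finite S" "S \<noteq> {}" for S
      unfolding bad_def using lamE_pos
      by (intro bad_sites_decay[OF ppp pppE indep s lam_s _ s2 k A T_def that]) auto
    from peierls[OF bad this] obtain G where G: "G \<in> events" "prob G > 0"
      and G0: "\<And>\<omega>. \<omega> \<in> G \<Longrightarrow> \<omega> \<notin> bad (0, 0)"
      and grow: "\<And>\<omega> C. \<omega> \<in> G \<Longrightarrow> finite C \<Longrightarrow> (0, 0) \<in> C \<Longrightarrow> \<exists>u\<in>C. \<exists>d\<in>dirs. u + d \<notin> C \<and> \<omega> \<notin> bad (u + d)"
      by blast
    let ?I = "{\<omega> \<in> space M. infinite (out_component l \<gamma> (insert 0 (\<Phi> \<omega>)) (\<Phi>E \<omega>) 0)}"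
    have "G \<subseteq> ?I"
    proof
      fix \<omega> assume \<omega>: "\<omega> \<in> G"
      then have sp: "\<omega> \<in> space M" using G(1) sets.sets_into_space by blast
      have "infinite (out_component l \<gamma> (insert 0 (\<Phi> \<omega>)) (\<Phi>E \<omega>) 0)"
      proof (rule infinite_out_component[OF l_range l_decreasing s
            locally_finite_config[OF \<Phi> sp] locally_finite_config[OF \<Phi>E sp] _ _ _ \<gamma>l])
        show "\<nexists>n. bad_site l s (T lam) (\<Phi> \<omega>) (\<Phi>E \<omega>) n (0, 0)"
          using G0[OF \<omega>] sp by (simp add: bad_def)
        show "\<exists>u\<in>C. \<exists>d\<in>dirs. u + d \<notin> C \<and> (\<nexists>n. bad_site l s (T lam) (\<Phi> \<omega>) (\<Phi>E \<omega>) n (u + d))"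
          if "finite C" "(0, 0) \<in> C" for C
          using grow[OF \<omega> that] sp by (simp add: bad_def)
      qed (use \<gamma> T[OF lam(1)] in auto)
      with sp show "\<omega> \<in> ?I" by simp
    qed
    \<comment> \<open>\<open>measure\<close> takes the value 0 on nonmeasurable sets, so the
      inclusion of \<open>G\<close> yields a lower bound only once the event is known to be
      measurable.\<close>
    moreover have "?I \<in> events"
      by (rule sets_infinite_out_component[OF attenuation_borel[OF l_range l_decreasing] \<Phi> \<Phi>E])
    ultimately have "prob G \<le> prob ?I" by (rule finite_measure_mono)
    with G(2) show "prob ?I > 0" by simp
  qed
qed

end
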